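(* Let $\delta$ be a rectifiable Jordan curve in $\mathbb{C}$ with image $\delta^*$, and let $U$ be the open Jordan region bounded by $\delta^*$. Let $f:\delta^*\to\mathbb{C}$ be a continuous function such that $\int_\delta P(z)f(z)\,dz=0$ for every polynomial $P$ with complex coefficients. Then there exists a holomorphic function $\varphi$ on $U$ such that, for almost all points $\zeta\in\delta^*$ with respect to the arc length measure $|dz|$, the non-tangential limit of $\varphi(z)$ as $z\to\zeta$, $z\in U$, exists and equals $f(\zeta)$.
   Context: A rectifiable Jordan curve is a simple closed curve of finite length; the open region bounded by it is the bounded component of $\mathbb{C}\setminus\delta^*$. Such a curve has a tangent at almost every point with respect to arc length. At a point $\zeta\in\delta^*$ where the tangent exists, $\varphi$ has non-tangential limit $L$ if, for every angle with vertex $\zeta$, symmetric about the inner normal at $\zeta$ and of opening less than $\pi$, $\varphi(z)\to L$ as $z\to\zeta$ with $z\in U$ inside that angle. *)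

theory Defs
  imports "HOL-Analysis.Analysis" "HOL-Computational_Algebra.Polynomial"
begin

definition polygon_lengths :: "(real \<Rightarrow> complex) \<Rightarrow> real \<Rightarrow> real \<Rightarrow> real set" where
  "polygon_lengths g a b =
     (\<lambda>D. \<Sum>K\<in>D. dist (g (Sup K)) (g (Inf K))) ` {D. D division_of {a..b}}"

definition rectifiable :: "(real \<Rightarrow> complex) \<Rightarrow> bool" where
  "rectifiable g \<longleftrightarrow> path g \<and> bdd_above (polygon_lengths g 0 1)"

definition arc_length :: "(real \<Rightarrow> complex) \<Rightarrow> real \<Rightarrow> real \<Rightarrow> real" where
  "arc_length g a b = Sup (polygon_lengths g a b)"

definition rectifiable_Jordan_curve :: "(real \<Rightarrow> complex) \<Rightarrow> bool" where
  "rectifiable_Jordan_curve g \<longleftrightarrow>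
     simple_path g \<and> pathfinish g = pathstart g \<and> rectifiable g"

text \<open>The measure \<open>|dz|\<close> on the curve: the Lebesgue-Stieltjes measure of the arc length function
  \<open>s(t)\<close>, \<open>0 \<le> t \<le> 1\<close>, extended to the real line by constants, is pushed forward along \<open>g\<close>.
  It is a Borel measure on the plane, concentrated on \<open>path_image g\<close>.\<close>

definition arc_length_measure :: "(real \<Rightarrow> complex) \<Rightarrow> complex measure" where
  "arc_length_measure g =
     distr (restrict_space (interval_measure (\<lambda>t. arc_length g 0 (max 0 (min 1 t)))) {0..1})
       borel g"

text \<open>The integral of \<open>f(z) dz\<close> along \<open>g\<close> is the Riemann-Stieltjes integral of \<open>f \<circ> g\<close> with respect
  to \<open>g\<close>. The library's contour integral uses the pointwise derivative of \<open>g\<close>, which does not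
  give this value when \<open>g\<close> is of bounded variation but not absolutely continuous.\<close>

definition has_line_integral ::
    "(complex \<Rightarrow> complex) \<Rightarrow> complex \<Rightarrow> (real \<Rightarrow> complex) \<Rightarrow> bool" where
  "has_line_integral f I g \<longleftrightarrow>
     (\<forall>e>0. \<exists>d>0. \<forall>p. p tagged_division_of {0..1} \<and> (\<lambda>t. ball t d) fine p \<longrightarrow>
        dist (\<Sum>(t, K)\<in>p. f (g t) * (g (Sup K) - g (Inf K))) I < e)"

text \<open>\<open>u\<close> is the unit tangent vector at \<open>\<zeta>\<close> in the direction of traversal. The closed curve is
  extended periodically by \<open>frac\<close>, so that the common end point needs no separate treatment;
  the directions of the secants make the notion independent of the parametrization.\<close>

definition has_unit_tangent :: "(real \<Rightarrow> complex) \<Rightarrow> complex \<Rightarrow> complex \<Rightarrow> bool" where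
  "has_unit_tangent g \<zeta> u \<longleftrightarrow>
     (\<exists>t. g (frac t) = \<zeta> \<and>
        ((\<lambda>x. sgn (g (frac x) - \<zeta>)) \<longlongrightarrow> u) (at_right t) \<and>
        ((\<lambda>x. sgn (g (frac x) - \<zeta>)) \<longlongrightarrow> - u) (at_left t))"

definition inner_unit_normal :: "(real \<Rightarrow> complex) \<Rightarrow> complex \<Rightarrow> complex \<Rightarrow> bool" where
  "inner_unit_normal g \<zeta> \<nu> \<longleftrightarrow>
     (\<exists>u. has_unit_tangent g \<zeta> u \<and> (\<nu> = \<i> * u \<or> \<nu> = - \<i> * u)) \<and>
     (\<forall>\<^sub>F r in at_right 0. \<zeta> + of_real r * \<nu> \<in> inside (path_image g))"

definition symmetric_angle :: "complex \<Rightarrow> complex \<Rightarrow> real \<Rightarrow> complex set" where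
  "symmetric_angle \<zeta> \<nu> \<theta> = {z. z \<noteq> \<zeta> \<and> \<bar>Arg ((z - \<zeta>) / \<nu>)\<bar> < \<theta> / 2}"

text \<open>At a point without a tangent there is no non-tangential limit.\<close>

definition has_nontangential_limit ::
    "(real \<Rightarrow> complex) \<Rightarrow> (complex \<Rightarrow> complex) \<Rightarrow> complex \<Rightarrow> complex \<Rightarrow> bool" where
  "has_nontangential_limit g \<phi> \<zeta> L \<longleftrightarrow>
     (\<exists>\<nu>. inner_unit_normal g \<zeta> \<nu> \<and>
        (\<forall>\<theta>. 0 < \<theta> \<and> \<theta> < pi \<longrightarrow>
           (\<phi> \<longlongrightarrow> L) (at \<zeta> within inside (path_image g) \<inter> symmetric_angle \<zeta> \<nu> \<theta>)))"

end

theory Submission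
  imports Defs "HOL-Complex_Analysis.Complex_Analysis"
begin

text \<open>The function \<open>\<phi>\<close> is the Cauchy integral of \<open>f\<close> along the curve, divided by \<open>2\<pi>i n\<close>, where
  \<open>n = \<plusminus>1\<close> is the winding number of the curve about the points of \<open>U\<close>.

  Expanding \<open>1 / (\<zeta> - z)\<close> in powers of \<open>\<zeta> / z\<close> shows that vanishing of the integrals of \<open>P f\<close> makes the Cauchy
  integral vanish for large \<open>\<bar>z\<bar>\<close>, hence, by analytic continuation, in the whole exterior domain
  (\<open>cauchy_integral_zero_outside\<close>). Now let \<open>\<zeta>\<^sub>0\<close> be a point with a tangent, \<open>z = \<zeta>\<^sub>0 + w\<close> a point close to
  it in an angle about the inner normal, and \<open>z' = \<zeta>\<^sub>0 - w\<close> its reflection, which lies outside. The Cauchy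
  integral is \<open>0\<close> at \<open>z'\<close>, and the winding numbers about \<open>z\<close> and \<open>z'\<close> are \<open>n\<close> and \<open>0\<close>, so that
  \<open>\<phi>(z) - f(\<zeta>\<^sub>0)\<close> is \<open>1 / (2\<pi>i n)\<close> times the integral of
  \<open>(f(\<zeta>) - f(\<zeta>\<^sub>0)) (1 / (\<zeta> - z) - 1 / (\<zeta> - z'))\<close>. In the arc length parameter \<open>s\<close> the difference of the two
  kernels is at most a constant times the Poisson kernel \<open>\<bar>w\<bar> / (\<bar>w\<bar>\<^sup>2 + (s - s\<^sub>0)\<^sup>2)\<close>, because the curve
  stays close to its tangent near \<open>\<zeta>\<^sub>0\<close> and away from \<open>\<zeta>\<^sub>0\<close> elsewhere (\<open>cone_estimate\<close>). Continuity
  of \<open>f\<close> at \<open>\<zeta>\<^sub>0\<close> then gives the limit (\<open>cauchy_integral_cone_limit\<close>).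

  Three further facts carry the argument. The arc length parametrization \<open>h\<close> has a derivative of modulus
  \<open>1\<close> almost everywhere (\<open>unit_derivative_ae\<close>): an inscribed polygon whose length is close to that of the
  curve has chords from which \<open>h\<close> rarely deviates, by a Vitali covering. The measure \<open>|dz|\<close> is the image of
  Lebesgue measure under \<open>h\<close> (\<open>arc_length_pushforward\<close>), and Stieltjes integrals along the curve
  become Lebesgue integrals with the density \<open>h'\<close> (\<open>line_integral_eq\<close>). Finally, the winding number
  jumps by \<open>1\<close> across the tangent (\<open>kernel_jump\<close>), so that one of the two normals points into \<open>U\<close> and
  the other into the exterior.\<close>

section \<open>Almost everywhere differentiability with unit speed\<close>

text \<open>For a curve with Lipschitz constant \<open>1\<close> and the mean velocity \<open>v\<close> of a chord, the function
  \<open>G x = (1 + \<bar>v\<bar>\<^sup>2) x - 2 h x \<bullet> v\<close> increases over an interval \<open>J\<close> by at least \<open>\<bar>k(J)\<bar>\<^sup>2 / \<bar>J\<bar>\<close>, where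
  \<open>k(J)\<close> is the deviation of the displacement over \<open>J\<close> from \<open>v \<bar>J\<bar>\<close>, while the total increase of \<open>G\<close> over \<open>[p, q]\<close> is
  \<open>(q - p) (1 - \<bar>v\<bar>\<^sup>2)\<close>, at most twice the deficit
  \<open>(q - p) - \<bar>h q - h p\<bar>\<close> of the chord. The intervals on which the deviation
  exceeds \<open>e \<bar>J\<bar>\<close> form a Vitali cover of \<open>B\<close>, and disjoint intervals of this kind have total
  length at most \<open>1 / e\<^sup>2\<close> times the Stieltjes measure of \<open>G\<close>.\<close>

lemma chord_deviation_cover:
  fixes h :: "real \<Rightarrow> complex"
  assumes lip: "\<And>x y. norm (h y - h x) \<le> \<bar>y - x\<bar>" and "p < q" and "0 < e"
  defines "v \<equiv> (h q - h p) /\<^sub>R (q - p)"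
  defines "B \<equiv> {s \<in> {p<..<q}. \<forall>d>0. \<exists>y. \<bar>y - s\<bar> < d \<and> e * \<bar>y - s\<bar> < norm (h y - h s - (y - s) *\<^sub>R v)}"
  shows "\<exists>W\<in>lmeasurable. B \<subseteq> W \<and>
    measure lebesgue W \<le> 2 / e\<^sup>2 * ((q - p) - norm (h q - h p))"
proof -
  define G where "G x = (1 + (norm v)\<^sup>2) * x - 2 * (h x \<bullet> v)" for x
  have G_diff: "(norm (h y - h x - (y - x) *\<^sub>R v))\<^sup>2 \<le> (y - x) * (G y - G x)" for x y
  proof -
    have "(norm (h y - h x))\<^sup>2 \<le> (y - x)\<^sup>2"
      using power_mono[OF lip[of y x] norm_ge_zero, of 2] by simp
    moreover have "(norm (h y - h x - (y - x) *\<^sub>R v))\<^sup>2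
        = (norm (h y - h x))\<^sup>2 - 2 * (y - x) * ((h y - h x) \<bullet> v) + (y - x)\<^sup>2 * (norm v)\<^sup>2"
      unfolding power2_norm_eq_inner
      by (simp add: inner_diff_left inner_diff_right inner_commute power2_eq_square algebra_simps)
    ultimately show ?thesis
      by (simp add: G_def algebra_simps power2_eq_square)
  qed
  have mono_G: "G x \<le> G y" if "x \<le> y" for x y
  proof (cases "x = y")
    case False
    then show ?thesis
      using order_trans[OF zero_le_power2 G_diff[of y x]] that by (simp add: zero_le_mult_iff)
  qed auto
  have cont_h: "continuous_on UNIV h"
    unfolding continuous_on_iff dist_norm using lip by (metis UNIV_I order_le_less_trans real_norm_def)
  then have cont_G: "continuous_on UNIV G"
    unfolding G_def by (intro continuous_intros)
  define M where "M = interval_measure G"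
  have M_Icc: "emeasure M {x..y} = ennreal (G y - G x)" if "x \<le> y" for x y
    unfolding M_def using that mono_G cont_G by (intro emeasure_interval_measure_Icc) auto

  \<comment> \<open>Closed intervals of large deviation, described by their centres \<open>a\<close> and radii \<open>r\<close> for the covering theorem.\<close>
  define K where "K = {(x,y). p < x \<and> x < y \<and> y < q \<and> e * (y - x) < norm (h y - h x - (y - x) *\<^sub>R v)}"
  define a where "a = (\<lambda>(x,y). (x + y) / 2 :: real)"
  define r where "r = (\<lambda>(x,y). (y - x) / 2 :: real)"
  have cball_eq: "cball (a i) (r i) = {fst i..snd i}" for i
    by (auto simp: cball_eq_atLeastAtMost a_def r_def case_prod_beta field_simps)
  then have mem_cball_eq: "s \<in> cball (a i) (r i) \<longleftrightarrow> fst i \<le> s \<and> s \<le> snd i" for s i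
    by simp
  have r_eq: "r i = (snd i - fst i) / 2" for i by (simp add: r_def case_prod_beta)
  have "\<exists>i\<in>K. s \<in> cball (a i) (r i) \<and> r i < d" if "s \<in> B" "0 < d" for s d
  proof -
    have "min d (min (s - p) (q - s)) > 0" using that by (auto simp: B_def)
    then obtain y where y: "\<bar>y - s\<bar> < min d (min (s - p) (q - s))"
        "e * \<bar>y - s\<bar> < norm (h y - h s - (y - s) *\<^sub>R v)"
      using \<open>s \<in> B\<close> unfolding B_def by blast
    then have "y \<noteq> s" by auto
    have nm: "norm (h s - h y - (s - y) *\<^sub>R v) = norm (h y - h s - (y - s) *\<^sub>R v)"
      by (subst norm_minus_cancel[symmetric]) (simp add: algebra_simps)
    show ?thesis
    proof (cases "s < y")
      case True
      then have "(s, y) \<in> K" using y \<open>s \<in> B\<close> by (auto simp: K_def B_def)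
      moreover have "s \<in> cball (a (s,y)) (r (s,y))" unfolding mem_cball_eq using True by simp
      moreover have "r (s,y) < d" unfolding r_eq using True y by simp
      ultimately show ?thesis by blast
    next
      case False
      then have "(y, s) \<in> K" using y \<open>s \<in> B\<close> \<open>y \<noteq> s\<close> nm by (auto simp: K_def B_def)
      moreover have "s \<in> cball (a (y,s)) (r (y,s))" unfolding mem_cball_eq using False by simp
      moreover have "r (y,s) < d" unfolding r_eq using False y by simp
      ultimately show ?thesis by blast
    qed
  qed
  then have vit: "\<And>s d. s \<in> B \<Longrightarrow> 0 < d \<Longrightarrow> \<exists>i. i \<in> K \<and> s \<in> cball (a i) (r i) \<and> r i < d" by blast
  have r_pos: "\<And>i. i \<in> K \<Longrightarrow> 0 < r i" by (auto simp: K_def r_def)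
  obtain C where C: "countable C" "C \<subseteq> K"
      "pairwise (\<lambda>i j. disjnt (cball (a i) (r i)) (cball (a j) (r j))) C"
      "negligible (B - (\<Union>i\<in>C. cball (a i) (r i)))"
    by (rule Vitali_covering_theorem_cballs[of K r B a, OF r_pos vit]) auto
  define W where "W = (\<Union>i\<in>C. {fst i..snd i})"
  have dis: "disjoint_family_on (\<lambda>i. {fst i..snd i}) C"
    using C(3) by (auto simp: disjoint_family_on_def pairwise_def disjnt_def cball_eq)
  have "emeasure lborel W = (\<integral>\<^sup>+i. emeasure lborel {fst i..snd i} \<partial>count_space C)"
    unfolding W_def by (intro emeasure_UN_countable dis C) auto
  also have "\<dots> \<le> (\<integral>\<^sup>+i. ennreal (1 / e\<^sup>2) * emeasure M {fst i..snd i} \<partial>count_space C)"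
  proof (intro nn_integral_mono)
    fix i assume "i \<in> space (count_space C)"
    then have i: "i \<in> K" using C by auto
    then have lt: "fst i < snd i" by (auto simp: K_def)
    have "(e * (snd i - fst i))\<^sup>2 \<le> (norm (h (snd i) - h (fst i) - (snd i - fst i) *\<^sub>R v))\<^sup>2"
      using i \<open>0 < e\<close> by (intro power_mono) (auto simp: K_def case_prod_beta)
    also have "\<dots> \<le> (snd i - fst i) * (G (snd i) - G (fst i))" by (rule G_diff)
    finally have "(snd i - fst i) * (e\<^sup>2 * (snd i - fst i)) \<le> (snd i - fst i) * (G (snd i) - G (fst i))"
      by (simp add: power2_eq_square algebra_simps)
    then have "e\<^sup>2 * (snd i - fst i) \<le> G (snd i) - G (fst i)"
      using lt by (simp add: mult_le_cancel_left_pos)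
    then have "snd i - fst i \<le> 1 / e\<^sup>2 * (G (snd i) - G (fst i))"
      using \<open>0 < e\<close> by (simp add: field_simps)
    then show "emeasure lborel {fst i..snd i} \<le> ennreal (1 / e\<^sup>2) * emeasure M {fst i..snd i}"
      using lt by (simp add: M_Icc less_imp_le ennreal_mult'[symmetric] ennreal_leI)
  qed
  also have "\<dots> = ennreal (1 / e\<^sup>2) * emeasure M W"
    unfolding W_def by (subst emeasure_UN_countable) (auto simp: dis C nn_integral_cmult M_def)
  also have "\<dots> \<le> ennreal (1 / e\<^sup>2) * emeasure M {p..q}"
  proof (intro mult_left_mono emeasure_mono)
    show "W \<subseteq> {p..q}" using C(2) by (fastforce simp: W_def K_def)
  qed (auto simp: M_def)
  also have "\<dots> = ennreal (1 / e\<^sup>2 * (G q - G p))"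
    using \<open>p < q\<close> by (simp add: M_Icc ennreal_mult'[symmetric])
  also have "\<dots> \<le> ennreal (2 / e\<^sup>2 * ((q - p) - norm (h q - h p)))"
  proof (rule ennreal_leI)
    have hv: "h q - h p = (q - p) *\<^sub>R v" using \<open>p < q\<close> by (simp add: v_def)
    have "norm v \<le> 1" using lip[of q p] \<open>p < q\<close> unfolding hv by simp
    have "G q - G p = (1 + (norm v)\<^sup>2) * (q - p) - 2 * ((h q - h p) \<bullet> v)"
      by (simp add: G_def algebra_simps)
    also have "\<dots> = (q - p) * (1 - norm v) * (1 + norm v)"
      by (simp add: hv power2_norm_eq_inner[symmetric] power2_eq_square algebra_simps)
    also have "\<dots> \<le> (q - p) * (1 - norm v) * 2"
      using \<open>norm v \<le> 1\<close> \<open>p < q\<close> by (intro mult_left_mono) auto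
    also have "\<dots> = 2 * ((q - p) - norm (h q - h p))"
      unfolding hv norm_scaleR using \<open>p < q\<close> by (simp add: algebra_simps)
    finally show "1 / e\<^sup>2 * (G q - G p) \<le> 2 / e\<^sup>2 * ((q - p) - norm (h q - h p))"
      using \<open>0 < e\<close> by (simp add: divide_right_mono)
  qed
  finally have emW: "emeasure lborel W \<le> ennreal (2 / e\<^sup>2 * ((q - p) - norm (h q - h p)))" .
  have W_borel: "W \<in> sets borel" unfolding W_def using C(1) by (intro sets.countable_UN') auto
  have Wm: "W \<in> lmeasurable"
    using emW W_borel by (auto simp: fmeasurable_def less_top[symmetric] top_unique)
  have neg: "negligible (B - W)" using C(4) by (simp add: W_def cball_eq)
  show ?thesis
  proof (intro bexI[of _ "W \<union> (B - W)"] conjI)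
    show "W \<union> (B - W) \<in> lmeasurable"
      using Wm neg by (intro fmeasurable.Un) (auto simp: negligible_iff_measure)
    have "measure lebesgue (W \<union> (B - W)) = measure lebesgue W"
    proof (rule measure_negligible_symdiff[of W])
      show "negligible (W - (W \<union> (B - W)) \<union> (W \<union> (B - W) - W))"
        by (rule negligible_subset[OF neg]) auto
    qed (use Wm in auto)
    also have "\<dots> \<le> 2 / e\<^sup>2 * ((q - p) - norm (h q - h p))"
    proof -
      have "0 \<le> 2 / e\<^sup>2 * ((q - p) - norm (h q - h p))" using lip[of q p] \<open>p < q\<close> by auto
      then show ?thesis using emW W_borel by (simp add: measure_def enn2real_leI)
    qed
    finally show "measure lebesgue (W \<union> (B - W)) \<le> 2 / e\<^sup>2 * ((q - p) - norm (h q - h p))" .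
  qed auto
qed

text \<open>The last assumption says that chords can be chosen with total deficit below any \<open>e\<close>, hence that
  \<open>h\<close> has length \<open>L\<close> on \<open>[0, L]\<close>. The chords may overlap: only their sum enters the measure estimates.
  The Lipschitz bound is required on the whole line, which is met by extending the curve by constants.\<close>

locale unit_speed_curve =
  fixes h :: "real \<Rightarrow> complex" and L :: real
  assumes L_pos: "0 < L"
    and lip: "norm (h y - h x) \<le> \<bar>y - x\<bar>"
    and chords: "0 < e \<Longrightarrow> \<exists>A. finite A \<and> (\<forall>(p,q)\<in>A. p \<le> q) \<and> {0..L} \<subseteq> (\<Union>(p,q)\<in>A. {p..q}) \<and>
        (\<Sum>(p,q)\<in>A. (q - p) - norm (h q - h p)) < e"
begin

lemma continuous_h: "continuous_on A h"
proof -
  have "continuous_on UNIV h"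
    unfolding continuous_on_iff dist_norm using lip by (metis UNIV_I order_le_less_trans real_norm_def)
  then show ?thesis by (rule continuous_on_subset) simp
qed

text \<open>The exceptional points of each chord have measure at most \<open>2 / e\<^sup>2\<close> times its deficit: either the chord is
  nearly of full length and the covering lemma applies, or its velocity is below \<open>1 - e\<close> and the
  whole interval is no longer than that. The total deficit is arbitrarily small.\<close>

lemma almost_chord_negligible:
  assumes e: "0 < e" "e \<le> 1"
  shows "negligible {s \<in> {0..L}. \<not> (\<exists>v. norm v \<le> 1 \<and> 1 - e \<le> norm v \<and>
            (\<exists>d>0. \<forall>y. \<bar>y - s\<bar> < d \<longrightarrow> norm (h y - h s - (y - s) *\<^sub>R v) \<le> e * \<bar>y - s\<bar>))}"
    (is "negligible ?N")
  unfolding negligible_outer_le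
proof (intro allI impI)
  fix \<eta> :: real assume "0 < \<eta>"
  define E where "E = \<eta> * e\<^sup>2 / 2"
  have "0 < E" using \<open>0 < \<eta>\<close> e by (simp add: E_def)
  then obtain A where A: "finite A" "\<forall>(p,q)\<in>A. p \<le> q" "{0..L} \<subseteq> (\<Union>(p,q)\<in>A. {p..q})"
      "(\<Sum>(p,q)\<in>A. (q - p) - norm (h q - h p)) < E"
    using chords[OF \<open>0 < E\<close>] by (elim exE conjE)
  have "\<exists>W. W \<in> lmeasurable \<and> ?N \<inter> {p..q} \<subseteq> W \<and>
           measure lebesgue W \<le> 2 / e\<^sup>2 * ((q - p) - norm (h q - h p))" if pq: "p \<le> q" for p q
  proof (cases "p = q")
    case True
    then show ?thesis by (intro exI[of _ "cbox p p"]) (simp only: lmeasurable_cbox, simp)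
  next
    case False
    with pq have "p < q" by simp
    define v where "v = (h q - h p) /\<^sub>R (q - p)"
    have hv: "norm (h q - h p) = (q - p) * norm v" using \<open>p < q\<close> by (simp add: v_def)
    have v1: "norm v \<le> 1" using lip[of q p] \<open>p < q\<close> unfolding hv by simp
    show ?thesis
    proof (cases "1 - e \<le> norm v")
      case True
      obtain W where W: "W \<in> lmeasurable"
          "{s \<in> {p<..<q}. \<forall>d>0. \<exists>y. \<bar>y - s\<bar> < d \<and> e * \<bar>y - s\<bar> < norm (h y - h s - (y - s) *\<^sub>R v)} \<subseteq> W"
          "measure lebesgue W \<le> 2 / e\<^sup>2 * ((q - p) - norm (h q - h p))"
        using chord_deviation_cover[OF lip \<open>p < q\<close> e(1)] unfolding v_def[symmetric] by (elim bexE conjE)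
      have "?N \<inter> {p..q} \<subseteq> W \<union> {p,q}"
      proof
        fix s assume s: "s \<in> ?N \<inter> {p..q}"
        have "\<exists>y. \<bar>y - s\<bar> < d \<and> e * \<bar>y - s\<bar> < norm (h y - h s - (y - s) *\<^sub>R v)" if "d > 0" for d
        proof (rule ccontr)
          assume "\<not> ?thesis"
          then have "\<forall>y. \<bar>y - s\<bar> < d \<longrightarrow> norm (h y - h s - (y - s) *\<^sub>R v) \<le> e * \<bar>y - s\<bar>"
            by (meson not_less)
          then show False using s v1 True that by blast
        qed
        moreover have "s \<in> {p<..<q} \<or> s \<in> {p,q}" using s by auto
        ultimately show "s \<in> W \<union> {p,q}" using W(2) by blast
      qed
      moreover have "W \<union> {p,q} \<in> lmeasurable" using W(1) negligible_finite[of "{p,q}"]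
        by (intro fmeasurable.Un) (simp_all add: negligible_iff_measure)
      moreover have "measure lebesgue (W \<union> {p,q}) = measure lebesgue W"
      proof (rule measure_negligible_symdiff[of W])
        show "negligible (W - (W \<union> {p,q}) \<union> (W \<union> {p,q} - W))"
          by (rule negligible_subset[of "{p,q}"]) auto
      qed (use W(1) in auto)
      ultimately show ?thesis using W(3) by (intro exI[of _ "W \<union> {p,q}"]) simp
    next
      case False
      have "e\<^sup>2 * (q - p) \<le> e * (q - p)" using e \<open>p < q\<close> by (simp add: power2_eq_square)
      also have "\<dots> \<le> (q - p) * (1 - norm v)" using False \<open>p < q\<close> by (simp add: mult.commute)
      also have "\<dots> = (q - p) - norm (h q - h p)" by (simp add: hv algebra_simps)
      also have "\<dots> \<le> 2 * ((q - p) - norm (h q - h p))" using lip[of q p] \<open>p < q\<close> by auto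
      finally have "q - p \<le> 2 / e\<^sup>2 * ((q - p) - norm (h q - h p))"
        using e by (simp add: field_simps)
      then show ?thesis using \<open>p < q\<close> by (intro exI[of _ "{p..q}"]) simp
    qed
  qed
  then have "\<forall>i. \<exists>W. fst i \<le> snd i \<longrightarrow> W \<in> lmeasurable \<and> ?N \<inter> {fst i..snd i} \<subseteq> W \<and>
           measure lebesgue W \<le> 2 / e\<^sup>2 * ((snd i - fst i) - norm (h (snd i) - h (fst i)))"
    unfolding ex_simps by (intro allI impI)
  from choice[OF this] obtain W where "\<forall>i. fst i \<le> snd i \<longrightarrow> W i \<in> lmeasurable \<and> ?N \<inter> {fst i..snd i} \<subseteq> W i \<and>
           measure lebesgue (W i) \<le> 2 / e\<^sup>2 * ((snd i - fst i) - norm (h (snd i) - h (fst i)))" ..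
  moreover have "fst i \<le> snd i" if "i \<in> A" for i using A(2) that by auto
  ultimately have W: "W i \<in> lmeasurable" "?N \<inter> {fst i..snd i} \<subseteq> W i"
      "measure lebesgue (W i) \<le> 2 / e\<^sup>2 * ((snd i - fst i) - norm (h (snd i) - h (fst i)))"
    if "i \<in> A" for i
    using that by (simp_all only:)
  have Wm: "W i \<in> lmeasurable" if "i \<in> A" for i by (rule W(1)[OF that])
  show "\<exists>T. ?N \<subseteq> T \<and> T \<in> lmeasurable \<and> measure lebesgue T \<le> \<eta>"
  proof (intro exI[of _ "\<Union>i\<in>A. W i"] conjI)
    show "?N \<subseteq> (\<Union>i\<in>A. W i)"
    proof
      fix s assume s: "s \<in> ?N"
      then have "s \<in> (\<Union>(p,q)\<in>A. {p..q})" using A(3) by blast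
      then obtain p q where pq: "(p,q) \<in> A" "s \<in> {p..q}" by blast
      then have "s \<in> W (p,q)" using s W(2)[of "(p,q)"] unfolding fst_conv snd_conv by blast
      with pq show "s \<in> (\<Union>i\<in>A. W i)" by blast
    qed
    show "(\<Union>i\<in>A. W i) \<in> lmeasurable" using A(1) Wm by (intro fmeasurable.finite_UN) auto
    have "measure lebesgue (\<Union>i\<in>A. W i) \<le> (\<Sum>i\<in>A. measure lebesgue (W i))"
      using A(1) Wm by (intro measure_UNION_le) auto
    also have "\<dots> \<le> (\<Sum>i\<in>A. 2 / e\<^sup>2 * (case i of (p,q) \<Rightarrow> (q - p) - norm (h q - h p)))"
    proof (rule sum_mono)
      fix i assume "i \<in> A"
      then show "measure lebesgue (W i) \<le> 2 / e\<^sup>2 * (case i of (p,q) \<Rightarrow> (q - p) - norm (h q - h p))"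
        using W(3)[of i] by (simp add: case_prod_beta)
    qed
    also have "\<dots> \<le> 2 / e\<^sup>2 * E"
      unfolding sum_distrib_left[symmetric] using A(4) e by (intro mult_left_mono) auto
    also have "\<dots> = \<eta>" using e by (simp add: E_def)
    finally show "measure lebesgue (\<Union>i\<in>A. W i) \<le> \<eta>" .
  qed
qed

text \<open>Outside the countably many exceptional sets for \<open>e = 1 / (n + 1)\<close>, the approximate velocities at a point form
  a Cauchy sequence, whose limit is the derivative.\<close>

theorem unit_derivative_ae:
  "negligible {s \<in> {0..L}. \<not> (\<exists>u. norm u = 1 \<and> (h has_vector_derivative u) (at s))}"
proof -
  define N where "N e = {s \<in> {0..L}. \<not> (\<exists>v. norm v \<le> 1 \<and> 1 - e \<le> norm v \<and>
            (\<exists>d>0. \<forall>y. \<bar>y - s\<bar> < d \<longrightarrow> norm (h y - h s - (y - s) *\<^sub>R v) \<le> e * \<bar>y - s\<bar>))}" for e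
  have neg: "negligible (\<Union>n. N (inverse (real (Suc n))))"
  proof -
    have "negligible (N (inverse (real (Suc n))))" for n
      unfolding N_def by (rule almost_chord_negligible) (simp_all add: inverse_le_1_iff)
    then show ?thesis by (intro negligible_countable_Union) auto
  qed
  show ?thesis
  proof (rule negligible_subset[OF neg], rule subsetI, rule ccontr)
    fix s assume s: "s \<in> {s \<in> {0..L}. \<not> (\<exists>u. norm u = 1 \<and> (h has_vector_derivative u) (at s))}"
      and "s \<notin> (\<Union>n. N (inverse (real (Suc n))))"
    define e where "e n = inverse (real (Suc n))" for n
    have e_pos: "0 < e n" for n by (simp add: e_def)
    have e_lim: "e \<longlonglongrightarrow> 0" unfolding e_def by (rule LIMSEQ_inverse_real_of_nat)
    have "\<exists>v. norm v \<le> 1 \<and> 1 - e n \<le> norm v \<and>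
            (\<exists>d>0. \<forall>y. \<bar>y - s\<bar> < d \<longrightarrow> norm (h y - h s - (y - s) *\<^sub>R v) \<le> e n * \<bar>y - s\<bar>)" for n
      using s \<open>s \<notin> _\<close> unfolding N_def e_def by blast
    then obtain v where v: "\<And>n. norm (v n) \<le> 1" "\<And>n. 1 - e n \<le> norm (v n)"
      and dv: "\<And>n. \<exists>d>0. \<forall>y. \<bar>y - s\<bar> < d \<longrightarrow> norm (h y - h s - (y - s) *\<^sub>R v n) \<le> e n * \<bar>y - s\<bar>"
      using choice[of "\<lambda>n v. norm v \<le> 1 \<and> 1 - e n \<le> norm v \<and>
            (\<exists>d>0. \<forall>y. \<bar>y - s\<bar> < d \<longrightarrow> norm (h y - h s - (y - s) *\<^sub>R v) \<le> e n * \<bar>y - s\<bar>)"] by blast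
    obtain d where d: "\<And>n. 0 < d n"
      "\<And>n y. \<bar>y - s\<bar> < d n \<Longrightarrow> norm (h y - h s - (y - s) *\<^sub>R v n) \<le> e n * \<bar>y - s\<bar>"
      using choice[of "\<lambda>n d. 0 < d \<and> (\<forall>y. \<bar>y - s\<bar> < d \<longrightarrow> norm (h y - h s - (y - s) *\<^sub>R v n) \<le> e n * \<bar>y - s\<bar>)"]
        dv by blast
    have dist_v: "norm (v m - v n) \<le> e m + e n" for m n
    proof -
      define y where "y = s + min (d m) (d n) / 2"
      have y: "0 < y - s" "y - s < d m" "y - s < d n" using d(1)[of m] d(1)[of n] by (auto simp: y_def min_def)
      have "(y - s) * norm (v m - v n) = norm ((h y - h s - (y - s) *\<^sub>R v n) - (h y - h s - (y - s) *\<^sub>R v m))"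
        using y by (simp add: scaleR_diff_right[symmetric])
      also have "\<dots> \<le> e n * \<bar>y - s\<bar> + e m * \<bar>y - s\<bar>"
        using y by (intro order_trans[OF norm_triangle_ineq4] add_mono d(2)) auto
      finally have "(y - s) * norm (v m - v n) \<le> (y - s) * (e m + e n)"
        using y by (simp add: algebra_simps)
      then show ?thesis using y by simp
    qed
    have "Cauchy v"
    proof (rule metric_CauchyI)
      fix \<epsilon> :: real assume "0 < \<epsilon>"
      then obtain M where M: "\<And>n. n \<ge> M \<Longrightarrow> e n < \<epsilon> / 2"
        using order_tendstoD(2)[OF e_lim, of "\<epsilon> / 2"] by (auto simp: eventually_sequentially)
      show "\<exists>M. \<forall>m\<ge>M. \<forall>n\<ge>M. dist (v m) (v n) < \<epsilon>"
        proof (intro exI[of _ M] allI impI)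
        fix m n assume "M \<le> m" "M \<le> n"
        then show "dist (v m) (v n) < \<epsilon>"
          using dist_v[of m n] M[of m] M[of n] by (simp add: dist_norm)
      qed
    qed
    then obtain u where u: "v \<longlonglongrightarrow> u" using Cauchy_convergent convergent_def by blast
    have "norm u = 1"
    proof (rule LIMSEQ_unique[OF tendsto_norm[OF u]])
      show "(\<lambda>n. norm (v n)) \<longlonglongrightarrow> 1"
        by (rule tendsto_sandwich[of "\<lambda>n. 1 - e n" _ _ "\<lambda>n. 1"])
           (use v e_lim in \<open>auto intro!: tendsto_eq_intros\<close>)
    qed
    moreover have "(h has_vector_derivative u) (at s)"
      unfolding has_vector_derivative_def has_derivative_at_alt
    proof (intro conjI allI impI)
      fix \<epsilon> :: real assume "0 < \<epsilon>"
      have "eventually (\<lambda>n. e n < \<epsilon> / 2 \<and> dist (v n) u < \<epsilon> / 2) sequentially"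
        using \<open>0 < \<epsilon>\<close> by (intro eventually_conj order_tendstoD(2)[OF e_lim] tendstoD[OF u]) auto
      then obtain n where n: "e n < \<epsilon> / 2" "dist (v n) u < \<epsilon> / 2"
        by (auto simp: eventually_sequentially)
      show "\<exists>d>0. \<forall>y. norm (y - s) < d \<longrightarrow> norm (h y - h s - (y - s) *\<^sub>R u) \<le> \<epsilon> * norm (y - s)"
      proof (intro exI[of _ "d n"] conjI allI impI d(1))
        fix y assume y: "norm (y - s) < d n"
        have "h y - h s - (y - s) *\<^sub>R u = (h y - h s - (y - s) *\<^sub>R v n) + (y - s) *\<^sub>R (v n - u)"
          by (simp add: algebra_simps)
        also have "norm \<dots> \<le> e n * \<bar>y - s\<bar> + \<bar>y - s\<bar> * dist (v n) u"
          using y by (intro order_trans[OF norm_triangle_ineq] add_mono d(2)) (auto simp: dist_norm)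
        also have "\<dots> = (e n + dist (v n) u) * \<bar>y - s\<bar>" by (simp add: algebra_simps)
        also have "\<dots> \<le> \<epsilon> * \<bar>y - s\<bar>" using n by (intro mult_right_mono) auto
        finally show "norm (h y - h s - (y - s) *\<^sub>R u) \<le> \<epsilon> * norm (y - s)" by simp
      qed
    qed (rule bounded_linear_scaleR_left)
    ultimately show False using s by blast
  qed
qed

end

section \<open>Arc length parametrization\<close>

lemma sum_over_division:
  fixes F :: "real \<Rightarrow> real"
  assumes "D division_of {a..b}" "a \<le> b"
  shows "(\<Sum>K\<in>D. F (Sup K) - F (Inf K)) = F b - F a"
proof -
  define p where "p = (\<lambda>K. (Inf K, K)) ` D"
  note D = division_ofD[OF assms(1)]
  have "p tagged_division_of {a..b}"
    unfolding tagged_division_of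
  proof (intro conjI allI impI)
    show "finite p" using D(1) by (simp add: p_def)
    fix x K assume "(x, K) \<in> p"
    then have K: "K \<in> D" "x = Inf K" by (auto simp: p_def)
    then obtain c d where cd: "K = {c..d}" "c \<le> d" using D(3,4)[of K] by (metis atLeastatMost_empty_iff box_real(2))
    then show "x \<in> K" using K by simp
    show "K \<subseteq> {a..b}" using D(2) K by blast
    show "\<exists>a b. K = cbox a b" using D(4) K by blast
  next
    fix x1 K1 x2 K2 assume "(x1,K1) \<in> p \<and> (x2,K2) \<in> p \<and> (x1,K1) \<noteq> (x2,K2)"
    then show "interior K1 \<inter> interior K2 = {}" by (intro D(5)) (auto simp: p_def)
  next
    have "{K. \<exists>x. (x, K) \<in> p} = D" by (auto simp: p_def)
    then show "\<Union>{K. \<exists>x. (x, K) \<in> p} = {a..b}" using D(6) by simp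
  qed
  from additive_tagged_division_1[OF assms(2) this, of F]
  show ?thesis unfolding p_def by (subst (asm) sum.reindex) (auto simp: inj_on_def)
qed

lemma polygon_lengths_extend:
  assumes "x \<in> polygon_lengths g a b" "a \<le> b" "b < c"
  shows "x + dist (g c) (g b) \<in> polygon_lengths g a c"
proof -
  obtain D where D: "D division_of {a..b}" "x = (\<Sum>K\<in>D. dist (g (Sup K)) (g (Inf K)))"
    using assms(1) by (auto simp: polygon_lengths_def)
  have "{{b..c}} division_of {b..c}" using division_of_self[of b c] \<open>b < c\<close> by simp
  then have "(D \<union> {{b..c}}) division_of ({a..b} \<union> {b..c})"
    by (intro division_disjoint_union D) auto
  moreover have "{a..b} \<union> {b..c} = {a..c}" using assms by auto
  moreover have "{b..c} \<notin> D" using division_ofD(2)[OF D(1), of "{b..c}"] \<open>b < c\<close> by auto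
  then have "(\<Sum>K\<in>D \<union> {{b..c}}. dist (g (Sup K)) (g (Inf K))) = x + dist (g c) (g b)"
    using division_ofD(1)[OF D(1)] \<open>b < c\<close> by (simp add: D(2))
  ultimately show ?thesis unfolding polygon_lengths_def by (intro image_eqI[where x = "D \<union> {{b..c}}"]) auto
qed

locale rectifiable_Jordan =
  fixes g :: "real \<Rightarrow> complex"
  assumes rectifiable_Jordan: "rectifiable_Jordan_curve g"
begin

definition S :: "real \<Rightarrow> real" where "S t = arc_length g 0 t"
definition L :: real where "L = S 1"

lemma simple: "simple_path g" and closed_path: "g 1 = g 0" and path: "path g"
  and bdd1: "bdd_above (polygon_lengths g 0 1)"
  using rectifiable_Jordan
  by (auto simp: rectifiable_Jordan_curve_def rectifiable_def pathfinish_def pathstart_def)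

lemma continuous_g: "continuous_on {0..1} g" using path by (simp add: path_def)

lemma bdd: "t \<le> 1 \<Longrightarrow> 0 \<le> t \<Longrightarrow> bdd_above (polygon_lengths g 0 t)"
proof (cases "t = 1")
  case False
  assume t: "t \<le> 1" "0 \<le> t"
  obtain B where B: "\<And>x. x \<in> polygon_lengths g 0 1 \<Longrightarrow> x \<le> B" using bdd1 by (auto simp: bdd_above_def)
  have "x \<le> B" if "x \<in> polygon_lengths g 0 t" for x
    using B[OF polygon_lengths_extend[OF that, of 1]] t False zero_le_dist[of "g 1" "g t"] by linarith
  then show ?thesis by (auto simp: bdd_above_def)
qed (use bdd1 in simp)

lemma dist_le_S: "dist (g b) (g a) \<le> S b - S a" if ab: "0 \<le> a" "a \<le> b" "b \<le> 1"
proof (cases "a = b")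
  case False
  then have "a < b" using ab by simp
  have "{{0..a}} division_of {0..a}" using division_of_self[of 0 a] ab by simp
  then have ne: "polygon_lengths g 0 a \<noteq> {}" by (auto simp: polygon_lengths_def)
  have "S a \<le> S b - dist (g b) (g a)"
    unfolding S_def[of a] arc_length_def
  proof (rule cSup_least[OF ne])
    fix x assume "x \<in> polygon_lengths g 0 a"
    then have "x + dist (g b) (g a) \<in> polygon_lengths g 0 b"
      using polygon_lengths_extend ab \<open>a < b\<close> by blast
    then have "x + dist (g b) (g a) \<le> S b"
      unfolding S_def arc_length_def using bdd ab by (intro cSup_upper) auto
    then show "x \<le> S b - dist (g b) (g a)" by simp
  qed
  then show ?thesis by simp
qed simp

lemma S_mono: "0 \<le> a \<Longrightarrow> a \<le> b \<Longrightarrow> b \<le> 1 \<Longrightarrow> S a \<le> S b"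
  using dist_le_S[of a b] zero_le_dist[of "g b" "g a"] by linarith

lemma S_strict_mono:
  assumes "0 \<le> a" "a < b" "b \<le> 1" shows "S a < S b"
proof -
  define m where "m = (a + b) / 2"
  have m: "a < m" "m < b" using assms by (auto simp: m_def)
  have "g m \<noteq> g a"
  proof
    assume "g m = g a"
    moreover have "m \<in> {0..1}" "a \<in> {0..1}" using m assms by auto
    ultimately have "m = a \<or> m = 0 \<and> a = 1 \<or> m = 1 \<and> a = 0"
      using simple unfolding simple_path_def loop_free_def by blast
    then show False using m assms by auto
  qed
  then have "0 < dist (g m) (g a)" by simp
  also have "\<dots> \<le> S m - S a" using dist_le_S[of a m] m assms by simp
  finally have "S a < S m" by simp
  also have "S m \<le> S b" using S_mono m assms by auto
  finally show ?thesis .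
qed

lemma S_0: "S 0 = 0"
proof -
  have "{{0::real}} division_of {0..0}" using division_of_self[of "0::real" 0] by simp
  moreover have "(\<Sum>K\<in>D. dist (g (Sup K)) (g (Inf K))) = 0" if "D division_of {0..0}" for D
    using that division_of_sing[of D "0::real"] by simp
  ultimately have "polygon_lengths g 0 0 = {0}" unfolding polygon_lengths_def by (force simp: image_def)
  then show ?thesis by (simp add: S_def arc_length_def)
qed

lemma arc_length_pos: "0 < L" using S_strict_mono[of 0 1] by (simp add: L_def S_0)

lemma fine_polygon:
  assumes "0 < e"
  obtains D where "D division_of {0..1}" "(\<Sum>K\<in>D. (S (Sup K) - S (Inf K)) - dist (g (Sup K)) (g (Inf K))) < e"
proof -
  have "{{0..1::real}} division_of {0..1}" using division_of_self[of 0 "1::real"] by simp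
  then have ne: "polygon_lengths g 0 1 \<noteq> {}" by (auto simp: polygon_lengths_def)
  have "L - e < Sup (polygon_lengths g 0 1)" using assms by (simp add: L_def S_def arc_length_def)
  then obtain D where D: "D division_of {0..1}" "L - e < (\<Sum>K\<in>D. dist (g (Sup K)) (g (Inf K)))"
    using less_cSup_iff[OF ne bdd1] by (auto simp: polygon_lengths_def)
  moreover have "(\<Sum>K\<in>D. S (Sup K) - S (Inf K)) = L"
    using sum_over_division[OF D(1), of S] by (simp add: S_0 L_def)
  ultimately show ?thesis by (intro that[of D]) (auto simp: sum_subtractf)
qed

lemma division_interval:
  assumes "D division_of {0..1::real}" "K \<in> D"
  shows "0 \<le> Inf K" "Inf K \<le> Sup K" "Sup K \<le> 1" "K = {Inf K..Sup K}"
proof -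
  obtain c d where "K = {c..d}" using division_ofD(4)[OF assms] by (metis box_real(2))
  moreover have "K \<noteq> {}" "K \<subseteq> {0..1}" using division_ofD(2,3)[OF assms] by auto
  ultimately show "0 \<le> Inf K" "Inf K \<le> Sup K" "Sup K \<le> 1" "K = {Inf K..Sup K}" by auto
qed

lemma defect_nonneg: "D division_of {0..1} \<Longrightarrow> K \<in> D \<Longrightarrow> 0 \<le> (S (Sup K) - S (Inf K)) - dist (g (Sup K)) (g (Inf K))"
  using division_interval[of D K] dist_le_S[of "Inf K" "Sup K"] by simp

text \<open>Let \<open>D\<close> be a division whose polygon misses less than \<open>e / 2\<close> of the length. Replacing the arc between two points
  \<open>a, b\<close> of one cell of \<open>D\<close> by a segment still gives a curve at least as long as the polygon, so
  \<open>S b - S a < dist (g b) (g a) + e / 2\<close>. Points close enough to \<open>t\<close> lie in a common cell with \<open>t\<close>.\<close>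

lemma continuous_S: "continuous_on {0..1} S"
  unfolding continuous_on_iff
proof (intro ballI allI impI)
  fix t :: real and e :: real assume t: "t \<in> {0..1}" and "0 < e"
  then obtain D where D: "D division_of {0..1}"
      "(\<Sum>K\<in>D. (S (Sup K) - S (Inf K)) - dist (g (Sup K)) (g (Inf K))) < e / 2"
    using fine_polygon[of "e / 2"] by auto
  \<comment> \<open>Only the cell containing \<open>a\<close> and \<open>b\<close> enters: the length missed by any single cell is below \<open>e / 2\<close>.\<close>
  have within: "S b - S a < dist (g b) (g a) + e / 2" if "K \<in> D" "a \<in> K" "b \<in> K" "a \<le> b" for K a b
  proof -
    have K: "Inf K \<le> a" "b \<le> Sup K" "0 \<le> Inf K" "Sup K \<le> 1"
      using division_interval[OF D(1) that(1)] that by (metis atLeastAtMost_iff)+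
    have "(S (Sup K) - S (Inf K)) - dist (g (Sup K)) (g (Inf K)) < e / 2"
      using D(2) member_le_sum[OF that(1), of "\<lambda>K. (S (Sup K) - S (Inf K)) - dist (g (Sup K)) (g (Inf K))"]
        defect_nonneg[OF D(1)] division_ofD(1)[OF D(1)] by auto
    moreover have "dist (g (Sup K)) (g b) \<le> S (Sup K) - S b" "dist (g a) (g (Inf K)) \<le> S a - S (Inf K)"
      using K that by (auto intro!: dist_le_S)
    moreover have "dist (g (Sup K)) (g (Inf K)) \<le> dist (g (Sup K)) (g b) + dist (g b) (g a) + dist (g a) (g (Inf K))"
      using dist_triangle[of "g (Sup K)" "g (Inf K)" "g b"] dist_triangle[of "g b" "g (Inf K)" "g a"] by linarith
    ultimately show ?thesis by linarith
  qed
  define E where "E = Inf ` D \<union> Sup ` D"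
  have "finite E" using division_ofD(1)[OF D(1)] by (simp add: E_def)
  from finite_set_avoid[OF this, of t] obtain d where d: "0 < d" "\<And>x. x \<in> E \<Longrightarrow> x \<noteq> t \<Longrightarrow> d \<le> dist t x" by blast
  obtain d' where d': "0 < d'" "\<And>x. x \<in> {0..1} \<Longrightarrow> dist x t < d' \<Longrightarrow> dist (g x) (g t) < e / 2"
    using continuous_g t \<open>0 < e\<close> unfolding continuous_on_iff by (meson half_gt_zero)
  show "\<exists>d>0. \<forall>x\<in>{0..1}. dist x t < d \<longrightarrow> dist (S x) (S t) < e"
  proof (intro exI[of _ "min d d'"] conjI ballI impI)
    show "0 < min d d'" using d d' by simp
    fix x :: real assume x: "x \<in> {0..1}" "dist x t < min d d'"
    then have "x \<in> \<Union>D" using division_ofD(6)[OF D(1)] by simp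
    then obtain K where K: "K \<in> D" "x \<in> K" by blast
    have K_eq: "K = {Inf K..Sup K}" using division_interval(4)[OF D(1) K(1)] .
    have end_pts: "\<not> (y \<noteq> t \<and> min x t \<le> y \<and> y \<le> max x t)" if "y \<in> {Inf K, Sup K}" for y
    proof
      assume y: "y \<noteq> t \<and> min x t \<le> y \<and> y \<le> max x t"
      then have "d \<le> dist t y" using d(2)[of y] that K(1) by (auto simp: E_def)
      moreover have "dist t y \<le> dist x t" using y by (auto simp: dist_real_def)
      ultimately show False using x by simp
    qed
    have "Inf K \<le> x" "x \<le> Sup K" using K(2) K_eq by (metis atLeastAtMost_iff)+
    then have "Inf K \<le> t" "t \<le> Sup K" using end_pts[of "Inf K"] end_pts[of "Sup K"] by auto
    then have tK: "t \<in> K" using K_eq by (metis atLeastAtMost_iff)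
    have dg: "dist (g x) (g t) < e / 2" using d'(2)[of x] x by simp
    show "dist (S x) (S t) < e"
    proof (cases "t \<le> x")
      case True
      then show ?thesis using within[OF K(1) tK K(2)] dg S_mono[of t x] t x by (simp add: dist_real_def)
    next
      case False
      then show ?thesis using within[OF K(1) K(2) tK] dg S_mono[of x t] t x by (simp add: dist_real_def dist_commute)
    qed
  qed
qed

text \<open>The argument is clamped to \<open>[0, L]\<close>, which makes \<open>h\<close> Lipschitz on the whole line.\<close>

definition T :: "real \<Rightarrow> real" where "T s = inv_into {0..1} S (max 0 (min L s))"
definition h :: "real \<Rightarrow> complex" where "h s = g (T s)"

lemma S_inj: "inj_on S {0..1}"
  by (rule inj_onI) (metis S_strict_mono atLeastAtMost_iff less_irrefl linorder_neqE)

lemma S_image: "S ` {0..1} = {0..L}"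
proof
  show "S ` {0..1} \<subseteq> {0..L}" using S_mono[of 0] S_mono[of _ 1] by (auto simp: S_0 L_def)
  show "{0..L} \<subseteq> S ` {0..1}"
  proof
    fix s assume "s \<in> {0..L}"
    then obtain t where "0 \<le> t" "t \<le> 1" "S t = s"
      using IVT'[of S 0 s 1] continuous_S by (auto simp: S_0 L_def)
    then show "s \<in> S ` {0..1}" by auto
  qed
qed

lemma S_in: "t \<in> {0..1} \<Longrightarrow> S t \<in> {0..L}" using S_image by blast

lemma T_S: "t \<in> {0..1} \<Longrightarrow> T (S t) = t"
  using S_in[of t] inv_into_f_f[OF S_inj] by (simp add: T_def)

lemma T_in: "T s \<in> {0..1}"
  unfolding T_def using inv_into_into[of "max 0 (min L s)" S "{0..1}"] arc_length_pos by (simp add: S_image)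

lemma S_T: "S (T s) = max 0 (min L s)"
  unfolding T_def by (rule f_inv_into_f) (use arc_length_pos in \<open>simp add: S_image\<close>)

lemma T_mono: "x \<le> y \<Longrightarrow> T x \<le> T y"
  using S_strict_mono[of "T y" "T x"] T_in[of x] T_in[of y] S_T[of x] S_T[of y] by (force simp: not_le[symmetric])

lemma h_S: "t \<in> {0..1} \<Longrightarrow> h (S t) = g t" by (simp add: h_def T_S)

lemma continuous_T: "continuous_on UNIV T"
proof -
  have "continuous_on (S ` {0..1}) (inv_into {0..1} S)"
    by (rule continuous_on_inv[OF continuous_S]) (auto simp: S_inj)
  then show ?thesis unfolding T_def S_image
    by (rule continuous_on_compose2) (use arc_length_pos in \<open>auto intro!: continuous_intros\<close>)
qed

lemma h_lip: "norm (h y - h x) \<le> \<bar>y - x\<bar>"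
proof -
  have *: "norm (h y - h x) \<le> y - x" if "x \<le> y" for x y
    using dist_le_S[of "T x" "T y"] T_mono[OF that] T_in[of x] T_in[of y] that
    by (auto simp: h_def dist_norm S_T)
  show ?thesis using *[of x y] *[of y x] by (cases "x \<le> y") (auto simp: norm_minus_commute)
qed

sublocale unit_speed_curve h L
proof
  show "0 < L" by (rule arc_length_pos)
  show "norm (h y - h x) \<le> \<bar>y - x\<bar>" for x y by (rule h_lip)
  fix e :: real assume "0 < e"
  then obtain D where D: "D division_of {0..1}"
      "(\<Sum>K\<in>D. (S (Sup K) - S (Inf K)) - dist (g (Sup K)) (g (Inf K))) < e"
    by (rule fine_polygon)
  define A where "A = (\<lambda>K. (S (Inf K), S (Sup K))) ` D"
  have K01: "Inf K \<in> {0..1}" "Sup K \<in> {0..1}" if "K \<in> D" for K using division_interval[OF D(1) that] by auto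
  have fin: "finite D" using division_ofD(1)[OF D(1)] .
  show "\<exists>A. finite A \<and> (\<forall>(p, q)\<in>A. p \<le> q) \<and> {0..L} \<subseteq> (\<Union>(p, q)\<in>A. {p..q}) \<and>
          (\<Sum>(p, q)\<in>A. q - p - norm (h q - h p)) < e"
  proof (intro exI[of _ A] conjI)
    show "finite A" using fin by (simp add: A_def)
    show "\<forall>(p, q)\<in>A. p \<le> q" using division_interval[OF D(1)] by (auto simp: A_def intro!: S_mono)
    show "{0..L} \<subseteq> (\<Union>(p, q)\<in>A. {p..q})"
    proof
      fix s assume "s \<in> {0..L}"
      then obtain t where t: "t \<in> {0..1}" "s = S t" using S_image by blast
      then obtain K where K: "K \<in> D" "t \<in> K" using division_ofD(6)[OF D(1)] by blast
      then have "t \<in> {Inf K..Sup K}" using division_interval(4)[OF D(1) K(1)] by simp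
      then have "s \<in> {S (Inf K)..S (Sup K)}" using t K01[OF K(1)] by (auto intro!: S_mono)
      then show "s \<in> (\<Union>(p, q)\<in>A. {p..q})" using K(1) by (auto simp: A_def)
    qed
    have "(\<Sum>(p, q)\<in>A. q - p - norm (h q - h p))
        \<le> (\<Sum>K\<in>D. (\<lambda>(p,q). q - p - norm (h q - h p)) (S (Inf K), S (Sup K)))"
      unfolding A_def
    proof (rule order_trans[OF sum_image_le[OF fin]])
      fix K assume "K \<in> D"
      then show "0 \<le> (\<lambda>(p,q). q - p - norm (h q - h p)) (S (Inf K), S (Sup K))"
        using defect_nonneg[OF D(1)] K01 by (simp add: h_S dist_norm)
    qed (simp add: o_def)
    also have "\<dots> = (\<Sum>K\<in>D. (S (Sup K) - S (Inf K)) - dist (g (Sup K)) (g (Inf K)))"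
      using K01 by (intro sum.cong) (auto simp: h_S dist_norm)
    finally show "(\<Sum>(p, q)\<in>A. q - p - norm (h q - h p)) < e" using D(2) by simp
  qed
qed

lemma h_inj: "x \<in> {0..L} \<Longrightarrow> y \<in> {0..L} \<Longrightarrow> h x = h y \<Longrightarrow> x = y \<or> x = 0 \<and> y = L \<or> x = L \<and> y = 0"
proof -
  assume xy: "x \<in> {0..L}" "y \<in> {0..L}" "h x = h y"
  then have "T x = T y \<or> T x = 0 \<and> T y = 1 \<or> T x = 1 \<and> T y = 0"
    using simple T_in unfolding simple_path_def loop_free_def h_def by blast
  then show ?thesis using S_T[of x] S_T[of y] xy by (auto simp: S_0 L_def)
qed

lemma path_image_h: "path_image g = h ` {0..L}"
  unfolding path_image_def S_image[symmetric] image_image using h_S by simp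

text \<open>Both measures assign \<open>s(b) - s(a)\<close> to \<open>(a, b]\<close>, where \<open>s\<close> is the arc length extended by constants: the preimage of
  \<open>(a, b]\<close> under \<open>T\<close> lies between \<open>(s(a), s(b)]\<close> and \<open>[s(a), s(b)]\<close>. The closed end is attained
  when \<open>a < 0\<close>.\<close>

lemma arc_length_pushforward:
  "interval_measure (\<lambda>t. arc_length g 0 (max 0 (min 1 t))) = distr (restrict_space lborel {0..L}) borel T"
proof -
  define R where "R t = S (max 0 (min 1 t))" for t
  have R_mono: "R x \<le> R y" if "x \<le> y" for x y unfolding R_def using that by (intro S_mono) auto
  have contR: "continuous_on UNIV R"
    unfolding R_def by (rule continuous_on_compose2[OF continuous_S]) (auto intro!: continuous_intros)
  have right: "continuous (at_right a) R" for a
    using contR by (auto simp: continuous_on_eq_continuous_within intro: continuous_within_subset)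
  have R_T: "R (T s) = s" if "s \<in> {0..L}" for s using T_in[of s] that by (simp add: R_def S_T)
  have T_meas: "T \<in> measurable (restrict_space lborel {0..L}) borel"
    using borel_measurable_continuous_onI[OF continuous_T] by (auto intro: measurable_restrict_space1)
  have "interval_measure R = distr (restrict_space lborel {0..L}) borel T"
  proof (rule measure_eqI_generator_eq[where \<Omega> = UNIV and E = "range (\<lambda>(a,b). {a<..b})" and A = "\<lambda>n. {-real n<..real n}"])
    show "Int_stable (range (\<lambda>(a,b). {a<..b::real}))"
    proof (rule Int_stableI)
      fix X Y :: "real set" assume "X \<in> range (\<lambda>(a,b). {a<..b})" "Y \<in> range (\<lambda>(a,b). {a<..b})"
      then obtain a b c d where "X = {a<..b}" "Y = {c<..d}" by auto
      then have "X \<inter> Y = (\<lambda>(a,b). {a<..b}) (max a c, min b d)" by (simp add: Int_greaterThanAtMost)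
      then show "X \<inter> Y \<in> range (\<lambda>(a,b). {a<..b})" by blast
    qed
    show "(\<Union>i. {-real i<..real i}) = UNIV"
    proof -
      have "x \<in> (\<Union>i. {-real i<..real i})" for x :: real
      proof -
        obtain n :: nat where "\<bar>x\<bar> < real n" using reals_Archimedean2 by blast
        then show ?thesis by (intro UN_I[of n]) auto
      qed
      then show ?thesis by blast
    qed
    show "emeasure (interval_measure R) {-real i<..real i} \<noteq> \<infinity>" for i
      using R_mono right by (simp add: emeasure_interval_measure_Ioc)
    fix X assume "X \<in> range (\<lambda>(a,b). {a<..b::real})"
    then obtain a b where X: "X = {a<..b}" by auto
    show "emeasure (interval_measure R) X = emeasure (distr (restrict_space lborel {0..L}) borel T) X"
    proof (cases "a \<le> b")
      case True
      define Y where "Y = T -` {a<..b} \<inter> {0..L}"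
      have R_in: "R t \<in> {0..L}" for t unfolding R_def by (rule S_in) auto
      have sub1: "{R a<..R b} \<subseteq> Y"
      proof
        fix s assume s: "s \<in> {R a<..R b}"
        then have s0: "s \<in> {0..L}" using R_in[of a] R_in[of b] by auto
        have "a < T s"
          using R_mono[of "T s" a] R_T[OF s0] s by (auto simp: not_le[symmetric])
        moreover have "T s \<le> b"
        proof (rule ccontr)
          assume "\<not> T s \<le> b"
          then have "max 0 (min 1 b) < T s \<or> b < 0" using T_in[of s] by auto
          then show False
          proof
            assume "max 0 (min 1 b) < T s"
            then have "R b < S (T s)" unfolding R_def using T_in[of s] by (intro S_strict_mono) auto
            then show False using s s0 by (simp add: S_T)
          next
            assume "b < 0"
            then have "R b = 0" by (simp add: R_def S_0)
            then show False using s R_in[of a] by auto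
          qed
        qed
        ultimately show "s \<in> Y" using s0 by (simp add: Y_def)
      qed
      have sub2: "Y \<subseteq> {R a..R b}"
      proof
        fix s assume s: "s \<in> Y"
        then have "R a \<le> R (T s)" "R (T s) \<le> R b" by (auto simp: Y_def intro!: R_mono)
        then show "s \<in> {R a..R b}" using s R_T by (auto simp: Y_def)
      qed
      have Y_meas: "Y \<in> sets lborel"
        using measurable_sets[OF T_meas, of "{a<..b}"] by (simp add: Y_def sets_restrict_space_iff space_restrict_space)
      have "emeasure lborel Y = ennreal (R b - R a)"
      proof (rule antisym)
        have "emeasure lborel Y \<le> emeasure lborel {R a..R b}" using sub2 by (intro emeasure_mono) auto
        then show "emeasure lborel Y \<le> ennreal (R b - R a)" using R_mono[OF True] by simp
        have "emeasure lborel {R a<..R b} \<le> emeasure lborel Y" using sub1 Y_meas by (intro emeasure_mono) auto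
        then show "ennreal (R b - R a) \<le> emeasure lborel Y" using R_mono[OF True] by simp
      qed
      moreover have "emeasure (distr (restrict_space lborel {0..L}) borel T) X = emeasure lborel Y"
        unfolding X by (subst emeasure_distr[OF T_meas]) (auto simp: Y_def space_restrict_space emeasure_restrict_space Int_commute)
      ultimately show ?thesis using True R_mono right by (simp add: X emeasure_interval_measure_Ioc)
    qed (simp add: X)
  qed (auto simp: borel_sigma_sets_Ioc)
  then show ?thesis by (simp add: R_def[abs_def] S_def)
qed

text \<open>The image under \<open>h\<close> of a null set of parameters need not be Borel. Covering \<open>B\<close> by open sets \<open>V n\<close> of
  small measure, the points not on any of the compact sets \<open>h ` ({0..L} - V n)\<close> form a Borel null set containing
  all the exceptional ones.\<close>

lemma AE_arc_length_measure:
  assumes "negligible B" and P: "\<And>s. s \<in> {0..L} - B \<Longrightarrow> P (h s)"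
  shows "AE \<zeta> in arc_length_measure g. P \<zeta>"
proof -
  have B: "B \<in> sets lebesgue" "emeasure lebesgue B = 0"
    using assms(1) by (auto simp: negligible_iff_null_sets null_setsD2 null_setsD1)
  have "\<exists>V. open V \<and> B \<subseteq> V \<and> emeasure lebesgue V \<le> ennreal (inverse (real (Suc n)))" for n
  proof -
    obtain V where V: "open V" "B \<subseteq> V" "V - B \<in> lmeasurable"
        "emeasure lebesgue (V - B) < ennreal (inverse (real (Suc n)))"
      using sets_lebesgue_outer_open[OF B(1), of "inverse (real (Suc n))"] by auto
    have "emeasure lebesgue V \<le> emeasure lebesgue (V - B) + emeasure lebesgue B"
      using V B(1) emeasure_subadditive[of "V - B" lebesgue B] by (simp add: Un_absorb2 fmeasurableD)
    then show ?thesis using V B(2) by (intro exI[of _ V]) auto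
  qed
  then have "\<forall>n. \<exists>V. open V \<and> B \<subseteq> V \<and> emeasure lebesgue V \<le> ennreal (inverse (real (Suc n)))" ..
  from choice[OF this] obtain V where
    "\<forall>n. open (V n) \<and> B \<subseteq> V n \<and> emeasure lebesgue (V n) \<le> ennreal (inverse (real (Suc n)))" ..
  then have V: "open (V n)" "B \<subseteq> V n" "emeasure lebesgue (V n) \<le> ennreal (inverse (real (Suc n)))" for n
    by blast+
  define N where "N = - (\<Union>n. h ` ({0..L} - V n))"
  have "compact (h ` ({0..L} - V n))" for n
    by (intro compact_continuous_image continuous_h compact_diff V) auto
  then have N: "N \<in> sets borel" unfolding N_def by (intro borel_comp sets.countable_UN') (auto intro: borel_compact)
  define \<mu> where "\<mu> = interval_measure (\<lambda>t. arc_length g 0 (max 0 (min 1 t)))"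
  have g_meas: "g \<in> measurable (restrict_space \<mu> {0..1}) borel"
    using borel_measurable_continuous_on_restrict[OF continuous_g]
    by (simp add: \<mu>_def cong: measurable_cong_sets sets_restrict_space_cong)
  define Y where "Y = g -` N \<inter> {0..1}"
  have Y_meas: "Y \<in> sets borel"
    using measurable_sets[OF g_meas N] by (simp add: Y_def sets_restrict_space_iff space_restrict_space \<mu>_def)
  have T_meas: "T \<in> measurable (restrict_space lborel {0..L}) borel"
    using borel_measurable_continuous_onI[OF continuous_T] by (auto intro: measurable_restrict_space1)
  have TY_meas: "T -` Y \<inter> {0..L} \<in> sets lborel"
    using measurable_sets[OF T_meas Y_meas] by (simp add: sets_restrict_space_iff space_restrict_space)
  have "emeasure (arc_length_measure g) N = emeasure \<mu> Y"
    unfolding arc_length_measure_def \<mu>_def[symmetric]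
    by (subst emeasure_distr[OF g_meas N])
       (auto simp: Y_def space_restrict_space emeasure_restrict_space \<mu>_def Int_commute)
  also have "\<dots> = emeasure lborel (T -` Y \<inter> {0..L})"
    unfolding \<mu>_def arc_length_pushforward
    by (subst emeasure_distr[OF T_meas Y_meas]) (auto simp: space_restrict_space emeasure_restrict_space Int_commute)
  also have "\<dots> = 0"
  proof (rule antisym)
    have sub: "T -` Y \<inter> {0..L} \<subseteq> V n" for n
      by (auto simp: Y_def N_def h_def)
    have "emeasure lborel (T -` Y \<inter> {0..L}) \<le> ennreal (inverse (real (Suc n)))" for n
    proof -
      have "emeasure lborel (T -` Y \<inter> {0..L}) = emeasure lebesgue (T -` Y \<inter> {0..L})" using TY_meas by simp
      also have "\<dots> \<le> emeasure lebesgue (V n)" using sub V(1)[of n] by (intro emeasure_mono) auto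
      also have "\<dots> \<le> ennreal (inverse (real (Suc n)))" by (rule V(3))
      finally show ?thesis .
    qed
    moreover have "(\<lambda>n. ennreal (inverse (real (Suc n)))) \<longlonglongrightarrow> ennreal 0"
      using LIMSEQ_inverse_real_of_nat by (intro tendsto_ennrealI)
    ultimately show "emeasure lborel (T -` Y \<inter> {0..L}) \<le> 0"
      by (intro LIMSEQ_le_const[where X = "\<lambda>n. ennreal (inverse (real (Suc n)))"]) auto
  qed simp
  finally have em: "emeasure (arc_length_measure g) N = 0" .
  show ?thesis
  proof (rule AE_I[OF _ em])
    show "N \<in> sets (arc_length_measure g)" using N by (simp add: arc_length_measure_def)
    show "{\<zeta> \<in> space (arc_length_measure g). \<not> P \<zeta>} \<subseteq> N"
      using P V(2) by (force simp: N_def)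
  qed
qed

end

section \<open>Integration along the curve\<close>

lemma vector_derivative_quotients:
  assumes "(f has_vector_derivative v) (at x)"
  shows "(\<lambda>n. real (Suc n) *\<^sub>R (f (x + inverse (real (Suc n))) - f x)) \<longlonglongrightarrow> v"
proof -
  have "(\<lambda>t. norm (f (x + t) - f x - t *\<^sub>R v) / norm t) \<midarrow>0\<rightarrow> 0"
    using assms by (simp add: has_vector_derivative_def has_derivative_at)
  moreover have "filterlim (\<lambda>n. inverse (real (Suc n))) (at 0) sequentially"
    unfolding filterlim_at using LIMSEQ_inverse_real_of_nat by auto
  ultimately have "(\<lambda>n. norm (f (x + inverse (real (Suc n))) - f x - inverse (real (Suc n)) *\<^sub>R v)
      / norm (inverse (real (Suc n)))) \<longlonglongrightarrow> 0"
    by (rule filterlim_compose)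
  moreover have "norm (f (x + inverse (real (Suc n))) - f x - inverse (real (Suc n)) *\<^sub>R v) / norm (inverse (real (Suc n)))
      = norm (real (Suc n) *\<^sub>R (f (x + inverse (real (Suc n))) - f x) - v)" for n
  proof -
    have "real (Suc n) *\<^sub>R (f (x + inverse (real (Suc n))) - f x) - v
        = real (Suc n) *\<^sub>R (f (x + inverse (real (Suc n))) - f x - inverse (real (Suc n)) *\<^sub>R v)"
      by (simp add: scaleR_diff_right del: of_nat_Suc)
    then show ?thesis by (simp add: divide_inverse mult.commute del: of_nat_Suc)
  qed
  ultimately show ?thesis by (simp add: tendsto_norm_zero_iff LIM_zero_iff del: of_nat_Suc)
qed

context unit_speed_curve
begin

text \<open>The density \<open>h'\<close> of \<open>dz\<close> with respect to arc length, set to \<open>0\<close> at the points without derivative so that its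
  modulus is at most \<open>1\<close> everywhere.\<close>

definition u :: "real \<Rightarrow> complex" where
  "u s = (if \<exists>v. (h has_vector_derivative v) (at s) then vector_derivative h (at s) else 0)"

lemma u_eq: "(h has_vector_derivative v) (at s) \<Longrightarrow> u s = v"
  by (auto simp: u_def vector_derivative_at)

lemma norm_u: "norm (u s) \<le> 1"
proof (cases "\<exists>v. (h has_vector_derivative v) (at s)")
  case True
  then obtain v where v: "(h has_vector_derivative v) (at s)" by blast
  have "norm v \<le> 1"
  proof (rule LIMSEQ_le_const2[OF tendsto_norm[OF vector_derivative_quotients[OF v]]], intro exI allI impI)
    fix n :: nat
    have "norm (h (s + inverse (real (Suc n))) - h s) \<le> inverse (real (Suc n))"
      using lip[of "s + inverse (real (Suc n))" s] by simp
    from mult_left_mono[OF this, of "real (Suc n)"]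
    show "norm (real (Suc n) *\<^sub>R (h (s + inverse (real (Suc n))) - h s)) \<le> 1"
      unfolding norm_scaleR by (simp del: of_nat_Suc)
  qed
  then show ?thesis using u_eq[OF v] by simp
qed (simp add: u_def)

text \<open>A Lipschitz curve is the integral of its derivative: by dominated convergence, the integral of \<open>u\<close> is the limit of the
  integrals of the difference quotients, which are differences of mean values of \<open>h\<close> over
  short intervals at \<open>b\<close> and at \<open>a\<close>.\<close>

lemma u_has_integral:
  assumes ab: "0 \<le> a" "a \<le> b" "b \<le> L"
  shows "(u has_integral (h b - h a)) {a..b}"
proof -
  define N where "N = {s \<in> {0..L}. \<not> (\<exists>u. norm u = 1 \<and> (h has_vector_derivative u) (at s))}"
  have N: "negligible N" unfolding N_def by (rule unit_derivative_ae)
  \<comment> \<open>The antiderivative is taken on a larger interval because the quotients reach beyond \<open>b\<close>.\<close>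
  obtain H where H0: "\<And>x. x \<in> {a-1..b+2} \<Longrightarrow> (H has_vector_derivative h x) (at x within {a-1..b+2})"
    using antiderivative_continuous[OF continuous_h] by blast
  have H: "(H has_vector_derivative h x) (at x)" if "a \<le> x" "x \<le> b + 1" for x
  proof -
    have "x \<in> interior {a-1..b+2}" using that by simp
    then have "at x within {a-1..b+2} = at x" by (rule at_within_interior)
    moreover have "x \<in> {a-1..b+2}" using that by simp
    ultimately show ?thesis using H0[of x] by simp
  qed
  define e where "e n = inverse (real (Suc n))" for n
  have e01: "0 < e n" "e n \<le> 1" for n by (auto simp: e_def field_simps)
  define q where "q n s = real (Suc n) *\<^sub>R (h (s + e n) - h s)" for n s
  have q_int: "(q n has_integral (real (Suc n) *\<^sub>R (H (b + e n) - H b) - real (Suc n) *\<^sub>R (H (a + e n) - H a))) {a..b}" for n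
  proof -
    have "(q n has_integral (real (Suc n) *\<^sub>R (H (b + e n) - H b)) - real (Suc n) *\<^sub>R (H (a + e n) - H a)) {a..b}"
      unfolding q_def
    proof (rule fundamental_theorem_of_calculus[OF ab(2)])
      fix s assume s: "s \<in> {a..b}"
      have "((\<lambda>s. H (s + e n)) has_vector_derivative h (s + e n)) (at s)"
        using vector_diff_chain_at[of "\<lambda>s. s + e n" 1 s H "h (s + e n)"] H[of "s + e n"] s e01[of n]
        by (auto simp: o_def has_vector_derivative_add_const has_vector_derivative_id)
      then have "((\<lambda>s. real (Suc n) *\<^sub>R (H (s + e n) - H s)) has_vector_derivative real (Suc n) *\<^sub>R (h (s + e n) - h s)) (at s)"
        using H[of s] s by (auto intro!: derivative_eq_intros)
      then show "((\<lambda>s. real (Suc n) *\<^sub>R (H (s + e n) - H s)) has_vector_derivative real (Suc n) *\<^sub>R (h (s + e n) - h s)) (at s within {a..b})"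
        by (rule has_vector_derivative_at_within)
    qed
    then show ?thesis by simp
  qed
  define q' where "q' n s = (if s \<in> N then 0 else q n s)" for n s
  define u' where "u' s = (if s \<in> N then 0 else u s)" for s
  have q'_int: "(q' n has_integral (real (Suc n) *\<^sub>R (H (b + e n) - H b) - real (Suc n) *\<^sub>R (H (a + e n) - H a))) {a..b}" for n
    by (rule has_integral_spike[OF N _ q_int]) (simp add: q'_def)
  have bound: "norm (q' n s) \<le> 1" for n s
  proof -
    have "norm (h (s + e n) - h s) \<le> e n"
      using lip[of "s + e n" s] e01[of n] by simp
    from mult_left_mono[OF this, of "real (Suc n)"] show ?thesis
      unfolding q'_def q_def e_def by (simp del: of_nat_Suc)
  qed
  have conv: "(\<lambda>n. q' n s) \<longlonglongrightarrow> u' s" if s: "s \<in> {a..b}" for s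
  proof (cases "s \<in> N")
    case False
    then obtain v where v: "(h has_vector_derivative v) (at s)" using s ab by (auto simp: N_def)
    from vector_derivative_quotients[OF v] show ?thesis using False u_eq[OF v] by (simp add: q'_def u'_def q_def e_def)
  qed (simp add: q'_def u'_def)
  have dom: "u' integrable_on {a..b}" "(\<lambda>n. integral {a..b} (q' n)) \<longlonglongrightarrow> integral {a..b} u'"
    using dominated_convergence[of q' "{a..b}" "\<lambda>_. 1::real" u'] q'_int bound conv
    by (auto intro: has_integral_integrable)
  have "(\<lambda>n. integral {a..b} (q' n)) \<longlonglongrightarrow> h b - h a"
    unfolding integral_unique[OF q'_int] e_def using ab
    by (intro tendsto_diff vector_derivative_quotients H) auto
  then have "integral {a..b} u' = h b - h a" using dom(2) LIMSEQ_unique by blast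
  then have "(u' has_integral (h b - h a)) {a..b}" using dom(1) by (simp add: has_integral_integrable_integral)
  then show ?thesis by (rule has_integral_spike[OF N, rotated]) (simp add: u'_def)
qed

lemma weighted_absolutely_integrable:
  assumes "continuous_on {a..b} F" "0 \<le> a" "b \<le> L"
  shows "(\<lambda>s. F s * u s) absolutely_integrable_on {a..b}"
proof (cases "a \<le> b")
  case True
  have "u absolutely_integrable_on {a..b}"
    using u_has_integral[of a b] True assms norm_u
    by (intro absolutely_integrable_integrable_bound[of "{a..b}" u "\<lambda>_. 1"]) auto
  moreover have "bounded (F ` {a..b})"
    using assms(1) by (intro compact_imp_bounded compact_continuous_image) auto
  ultimately show ?thesis
    using assms by (intro absolutely_integrable_bounded_measurable_product[OF bilinear_times])
      (auto intro!: continuous_imp_measurable_on_sets_lebesgue)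
qed auto

lemma weighted_integrable:
  "continuous_on {a..b} F \<Longrightarrow> 0 \<le> a \<Longrightarrow> b \<le> L \<Longrightarrow> (\<lambda>s. F s * u s) integrable_on {a..b}"
  using weighted_absolutely_integrable set_lebesgue_integral_eq_integral(1) by blast

lemma weighted_integral_bound:
  assumes "continuous_on {a..b} F" "0 \<le> a" "b \<le> L" "B integrable_on {a..b}" "\<And>s. s \<in> {a..b} \<Longrightarrow> norm (F s) \<le> B s"
  shows "norm (integral {a..b} (\<lambda>s. F s * u s)) \<le> integral {a..b} B"
proof (rule integral_norm_bound_integral[OF weighted_integrable[OF assms(1-3)] assms(4)])
  fix s assume "s \<in> {a..b}"
  then show "norm (F s * u s) \<le> B s"
    using mult_left_mono[OF norm_u[of s] norm_ge_zero[of "F s"]] assms(5)[of s] by (simp add: norm_mult)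
qed

lemma weighted_integral_const: 
  assumes "0 \<le> a" "a \<le> b" "b \<le> L"
  shows "integral {a..b} (\<lambda>s. c * u s) = c * (h b - h a)"
  using has_integral_mult_right[OF u_has_integral[OF assms], of c] by (rule integral_unique)

text \<open>Although \<open>u\<close> is only measurable, the indefinite integral of \<open>F u\<close> has the increment \<open>F s (h y - h s)\<close> to first
  order at every point \<open>s\<close>. Two such integrals with the same \<open>F\<close> therefore differ by a function
  whose derivative is \<open>0\<close> everywhere.\<close>

lemma primitive_increment:
  assumes F: "continuous_on {0..L} F" and s: "s \<in> {0..L}" and e: "0 < e"
  shows "\<exists>d>0. \<forall>y\<in>{0..L}. \<bar>y - s\<bar> < d \<longrightarrow>
     norm (integral {0..y} (\<lambda>s. F s * u s) - integral {0..s} (\<lambda>s. F s * u s) - F s * (h y - h s)) \<le> e * \<bar>y - s\<bar>"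
proof -
  obtain d where d: "0 < d" "\<And>y. y \<in> {0..L} \<Longrightarrow> \<bar>y - s\<bar> < d \<Longrightarrow> norm (F y - F s) < e"
    using F s e unfolding continuous_on_iff dist_norm by (metis real_norm_def)
  have piece: "norm (integral {a..b} (\<lambda>x. F x * u x) - F s * (h b - h a)) \<le> e * (b - a)"
    and split: "integral {0..b} (\<lambda>x. F x * u x) - integral {0..a} (\<lambda>x. F x * u x) = integral {a..b} (\<lambda>x. F x * u x)"
    if ab: "0 \<le> a" "a \<le> b" "b \<le> L" "\<bar>a - s\<bar> < d" "\<bar>b - s\<bar> < d" for a b
  proof -
    have cont: "continuous_on {a..b} F" by (rule continuous_on_subset[OF F]) (use ab in auto)
    have "norm (integral {a..b} (\<lambda>x. (F x - F s) * u x)) \<le> integral {a..b} (\<lambda>_. e)"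
    proof (rule weighted_integral_bound)
      fix x assume "x \<in> {a..b}"
      then show "norm (F x - F s) \<le> e" using ab d(2)[of x] by (auto intro: less_imp_le)
    qed (use ab cont in \<open>auto intro!: continuous_intros\<close>)
    moreover have "integral {a..b} (\<lambda>x. (F x - F s) * u x) = integral {a..b} (\<lambda>x. F x * u x) - F s * (h b - h a)"
      using weighted_integral_const[where a = a and b = b and c = "F s"] ab weighted_integrable[OF cont] weighted_integrable[where a = a and b = b and F = "\<lambda>_. F s"]
      by (simp add: left_diff_distrib integral_diff)
    ultimately show "norm (integral {a..b} (\<lambda>x. F x * u x) - F s * (h b - h a)) \<le> e * (b - a)"
      using ab by (simp add: mult.commute)
    have "continuous_on {0..b} F" by (rule continuous_on_subset[OF F]) (use ab in auto)
    then show "integral {0..b} (\<lambda>x. F x * u x) - integral {0..a} (\<lambda>x. F x * u x) = integral {a..b} (\<lambda>x. F x * u x)"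
      using Henstock_Kurzweil_Integration.integral_combine[where a = 0 and c = a and b = b and f = "\<lambda>x. F x * u x"] weighted_integrable[where a = 0 and b = b and F = F] ab by (simp add: algebra_simps)
  qed
  show ?thesis
  proof (intro exI[of _ d] conjI ballI impI d(1))
    fix y assume y: "y \<in> {0..L}" "\<bar>y - s\<bar> < d"
    show "norm (integral {0..y} (\<lambda>s. F s * u s) - integral {0..s} (\<lambda>s. F s * u s) - F s * (h y - h s)) \<le> e * \<bar>y - s\<bar>"
    proof (cases "s \<le> y")
      case True
      then show ?thesis using piece[of s y] split[of s y] y s d(1) by simp
    next
      case False
      have "norm (integral {0..y} (\<lambda>s. F s * u s) - integral {0..s} (\<lambda>s. F s * u s) - F s * (h y - h s))
         = norm (integral {0..s} (\<lambda>s. F s * u s) - integral {0..y} (\<lambda>s. F s * u s) - F s * (h s - h y))"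
        by (subst norm_minus_cancel[symmetric]) (simp add: algebra_simps)
      then show ?thesis using False piece[of y s] split[of y s] y s d(1) by simp
    qed
  qed
qed

text \<open>The increments of \<open>\<Phi> \<circ> h\<close> and of the indefinite integral of \<open>F u\<close> agree to first order at every point, so
  their difference has derivative \<open>0\<close> on all of \<open>[a, b]\<close>, without an exceptional set.\<close>

lemma chain_rule_integral:
  assumes ab: "0 \<le> a" "a \<le> b" "b \<le> L" and F: "continuous_on {0..L} F"
    and \<Phi>: "\<And>s. s \<in> {a..b} \<Longrightarrow> (\<Phi> has_field_derivative F s) (at (h s))"
  shows "integral {a..b} (\<lambda>s. F s * u s) = \<Phi> (h b) - \<Phi> (h a)"
proof -
  define I where "I y = integral {0..y} (\<lambda>s. F s * u s)" for y
  have "((\<lambda>y. \<Phi> (h y) - I y) has_derivative (\<lambda>_. 0)) (at s within {a..b})" if s: "s \<in> {a..b}" for s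
    unfolding has_derivative_within_alt
  proof (intro conjI allI impI)
    fix e :: real assume "0 < e"
    have s': "s \<in> {0..L}" using s ab by auto
    have e2: "0 < e / 2" using \<open>0 < e\<close> by simp
    obtain d1 where d1: "0 < d1" "\<forall>y\<in>{0..L}. \<bar>y - s\<bar> < d1 \<longrightarrow>
        norm (I y - I s - F s * (h y - h s)) \<le> e / 2 * \<bar>y - s\<bar>"
      using primitive_increment[OF F s' e2] unfolding I_def by (elim exE conjE)
    have "\<exists>d>0. \<forall>z. norm (z - h s) < d \<longrightarrow> norm (\<Phi> z - \<Phi> (h s) - F s * (z - h s)) \<le> e / 2 * norm (z - h s)"
      using \<Phi>[OF s, unfolded has_field_derivative_def has_derivative_at_alt, THEN conjunct2, rule_format, OF e2] .
    then obtain d2 where d2: "0 < d2" "\<And>z. norm (z - h s) < d2 \<Longrightarrow> norm (\<Phi> z - \<Phi> (h s) - F s * (z - h s)) \<le> e / 2 * norm (z - h s)"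
      by auto
    show "\<exists>d>0. \<forall>y\<in>{a..b}. norm (y - s) < d \<longrightarrow> norm (\<Phi> (h y) - I y - (\<Phi> (h s) - I s) - 0) \<le> e * norm (y - s)"
    proof (intro exI[of _ "min d1 d2"] conjI ballI impI)
      fix y assume y: "y \<in> {a..b}" "norm (y - s) < min d1 d2"
      have hy: "norm (h y - h s) \<le> \<bar>y - s\<bar>" by (rule lip)
      have "norm (\<Phi> (h y) - \<Phi> (h s) - F s * (h y - h s)) \<le> e / 2 * norm (h y - h s)"
        using hy y by (intro d2(2)) auto
      also have "\<dots> \<le> e / 2 * \<bar>y - s\<bar>" using hy \<open>0 < e\<close> by (intro mult_left_mono) auto
      finally have 1: "norm (\<Phi> (h y) - \<Phi> (h s) - F s * (h y - h s)) \<le> e / 2 * \<bar>y - s\<bar>" .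
      have 2: "norm (I y - I s - F s * (h y - h s)) \<le> e / 2 * \<bar>y - s\<bar>"
        using y ab d1(2) by auto
      have "\<Phi> (h y) - I y - (\<Phi> (h s) - I s) - 0
          = (\<Phi> (h y) - \<Phi> (h s) - F s * (h y - h s)) - (I y - I s - F s * (h y - h s))" by simp
      also have "norm \<dots> \<le> e / 2 * \<bar>y - s\<bar> + e / 2 * \<bar>y - s\<bar>"
        by (intro order_trans[OF norm_triangle_ineq4] add_mono 1 2)
      finally show "norm (\<Phi> (h y) - I y - (\<Phi> (h s) - I s) - 0) \<le> e * norm (y - s)" by (simp add: field_simps)
    qed (use d1 d2 in simp)
  qed simp
  then have "\<exists>c. \<forall>y\<in>{a..b}. \<Phi> (h y) - I y = c"
    by (intro has_derivative_zero_constant) auto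
  then have "\<Phi> (h b) - I b = \<Phi> (h a) - I a" using ab by force
  moreover have "continuous_on {0..b} F" by (rule continuous_on_subset[OF F]) (use ab in auto)
  then have "I b - I a = integral {a..b} (\<lambda>x. F x * u x)"
    using Henstock_Kurzweil_Integration.integral_combine[where a = 0 and c = a and b = b and f = "\<lambda>x. F x * u x"] weighted_integrable[where a = 0 and b = b and F = F] ab by (simp add: algebra_simps I_def)
  ultimately show ?thesis by (simp add: algebra_simps)
qed

lemma off_path: "z \<notin> h ` {0..L} \<Longrightarrow> s \<in> {0..L} \<Longrightarrow> h s \<noteq> z" by auto

lemma kernel_continuous: "z \<notin> h ` {0..L} \<Longrightarrow> continuous_on {0..L} (\<lambda>s. 1 / (h s - z))"
  by (intro continuous_intros continuous_h) auto

text \<open>The factor \<open>c\<close> selects the branch of the logarithm: the cut is the ray where \<open>c (\<zeta> - z)\<close> is a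
  nonpositive real number.\<close>

lemma log_increment:
  assumes z: "z \<notin> h ` {0..L}" and ab: "0 \<le> a" "a \<le> b" "b \<le> L"
    and c: "\<And>s. s \<in> {a..b} \<Longrightarrow> c * (h s - z) \<notin> \<real>\<^sub>\<le>\<^sub>0"
  shows "integral {a..b} (\<lambda>s. 1 / (h s - z) * u s) = Ln (c * (h b - z)) - Ln (c * (h a - z))"
proof (rule chain_rule_integral[OF ab kernel_continuous[OF z]])
  fix s assume s: "s \<in> {a..b}"
  have "c * (h s - z) \<noteq> 0" using c[OF s] by auto
  then have [simp]: "c \<noteq> 0" "h s \<noteq> z" by auto
  show "((\<lambda>w. Ln (c * (w - z))) has_field_derivative 1 / (h s - z)) (at (h s))"
    using c[OF s] by (auto intro!: derivative_eq_intros simp: field_simps)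
qed

text \<open>The indefinite integral of \<open>1 / (h - z)\<close> is a continuous logarithm of \<open>(h - z) / (h 0 - z)\<close>. On short arcs this is
  the formula for a branch of the logarithm, so \<open>(h - z) exp (-I)\<close> is locally constant, hence constant.\<close>

lemma exp_lift:
  assumes z: "z \<notin> h ` {0..L}" and y: "y \<in> {0..L}"
  shows "h y - z = (h 0 - z) * exp (integral {0..y} (\<lambda>s. 1 / (h s - z) * u s))"
proof -
  define I where "I y = integral {0..y} (\<lambda>s. 1 / (h s - z) * u s)" for y
  define K where "K y = (h y - z) * exp (- I y)" for y
  have piece: "exp (I b - I a) = (h b - z) / (h a - z)"
    if ab: "0 \<le> a" "a \<le> b" "b \<le> L" and s: "s \<in> {a..b}" "\<bar>a - s\<bar> < norm (h s - z)" "\<bar>b - s\<bar> < norm (h s - z)" for a b s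
  proof -
    have nz: "h s - z \<noteq> 0" "h a - z \<noteq> 0" "h b - z \<noteq> 0" using s ab off_path[OF z] by auto
    have "inverse (h s - z) * (h x - z) \<notin> \<real>\<^sub>\<le>\<^sub>0" if x: "x \<in> {a..b}" for x
    proof -
      have "norm (h x - h s) < norm (h s - z)"
        using lip[of x s] x s by auto
      then have "norm ((h x - h s) / (h s - z)) < 1" using nz by (simp add: norm_divide)
      moreover have "inverse (h s - z) * (h x - z) = 1 + (h x - h s) / (h s - z)" using nz by (simp add: field_simps)
      moreover have "- norm ((h x - h s) / (h s - z)) \<le> Re ((h x - h s) / (h s - z))"
        using abs_Re_le_cmod[of "(h x - h s) / (h s - z)"] by linarith
      ultimately have "0 < Re (inverse (h s - z) * (h x - z))" by simp
      then show ?thesis by (auto simp: complex_nonpos_Reals_iff)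
    qed
    then have "integral {a..b} (\<lambda>s. 1 / (h s - z) * u s) = Ln (inverse (h s - z) * (h b - z)) - Ln (inverse (h s - z) * (h a - z))"
      by (intro log_increment[OF z ab]) auto
    moreover have "continuous_on {0..b} (\<lambda>s. 1 / (h s - z))" by (rule continuous_on_subset[OF kernel_continuous[OF z]]) (use ab in auto)
    then have "I b - I a = integral {a..b} (\<lambda>s. 1 / (h s - z) * u s)"
      using Henstock_Kurzweil_Integration.integral_combine[where a = 0 and c = a and b = b and f = "\<lambda>s. 1 / (h s - z) * u s"] weighted_integrable[where a = 0 and b = b and F = "\<lambda>s. 1 / (h s - z)"] ab
      by (simp add: algebra_simps I_def)
    ultimately have "I b - I a = Ln (inverse (h s - z) * (h b - z)) - Ln (inverse (h s - z) * (h a - z))" by simp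
    then have "exp (I b - I a) = exp (Ln (inverse (h s - z) * (h b - z)) - Ln (inverse (h s - z) * (h a - z)))" by simp
    then show ?thesis using nz by (simp only: exp_diff) simp
  qed
  have "(K has_derivative (\<lambda>_. 0)) (at s within {0..L})" if s: "s \<in> {0..L}" for s
  proof (rule has_derivative_transform_within[of "\<lambda>_. K s" _ s "{0..L}" "norm (h s - z)"])
    fix y assume y: "y \<in> {0..L}" "dist y s < norm (h s - z)"
    have nz: "h s - z \<noteq> 0" "h y - z \<noteq> 0" using s y off_path[OF z] by auto
    have "exp (I y - I s) = (h y - z) / (h s - z)"
    proof (cases "s \<le> y")
      case True
      then show ?thesis using y s nz piece[of s y s] by (simp add: dist_real_def)
    next
      case False
      then have "exp (I s - I y) = (h s - z) / (h y - z)" using y s nz piece[of y s s] by (simp add: dist_real_def)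
      then show ?thesis using nz by (simp add: exp_diff field_simps)
    qed
    then show "K s = K y" using nz by (simp add: K_def exp_diff exp_minus field_simps)
  qed (use s off_path[OF z] in auto)
  then have "\<exists>c. \<forall>y\<in>{0..L}. K y = c" by (intro has_derivative_zero_constant) auto
  then have "K y = K 0" using y L_pos by force
  then show ?thesis by (simp add: K_def I_def exp_minus field_simps)
qed

end

context rectifiable_Jordan
begin

lemma winding_number_integral:
  assumes "z \<notin> path_image g"
  shows "integral {0..L} (\<lambda>s. 1 / (h s - z) * u s) = 2 * of_real pi * \<i> * winding_number g z"
proof -
  have z: "z \<notin> h ` {0..L}" using assms path_image_h by simp
  define I where "I y = integral {0..y} (\<lambda>s. 1 / (h s - z) * u s)" for y
  have nz: "h 0 - z \<noteq> 0" using off_path[OF z, of 0] L_pos by auto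
  define p where "p t = Ln (h 0 - z) + I (S t)" for t
  have "continuous_on {0..L} I"
    unfolding I_def by (rule indefinite_integral_continuous_1[OF weighted_integrable[OF kernel_continuous[OF z]]]) auto
  then have "continuous_on {0..1} p"
    unfolding p_def by (intro continuous_intros continuous_on_compose2[OF _ continuous_S]) (auto simp: S_image)
  then have "path p" by (simp add: path_def)
  have "winding_number g z = winding_number (\<lambda>t. g t - z) 0" by (rule winding_number_offset)
  also have "\<dots> = winding_number (exp \<circ> p) 0"
  proof (rule winding_number_cong)
    fix t :: real assume t: "0 \<le> t" "t \<le> 1"
    then have "h (S t) - z = (h 0 - z) * exp (I (S t))"
      unfolding I_def by (intro exp_lift[OF z] S_in) auto
    then show "g t - z = (exp \<circ> p) t" using t nz by (simp add: h_S p_def exp_add)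
  qed
  also have "\<dots> = (pathfinish p - pathstart p) / (2 * of_real pi * \<i>)"
    by (rule winding_number_compose_exp[OF \<open>path p\<close>])
  also have "pathfinish p - pathstart p = I L" by (simp add: pathfinish_def pathstart_def p_def S_0 L_def I_def)
  finally show ?thesis by (simp add: I_def)
qed

text \<open>The term of the Riemann-Stieltjes sum with tag \<open>t\<close> differs from the integral of \<open>F (h s) u s\<close> over its cell by at most
  the oscillation of \<open>F\<close> on the cell times the length of the corresponding arc.\<close>

lemma line_integral_eq:
  assumes F: "continuous_on (path_image g) F" and I: "has_line_integral F I g"
  shows "I = integral {0..L} (\<lambda>s. F (h s) * u s)"
proof -
  define G where "G s = F (h s) * u s" for s
  define J where "J = integral {0..L} G"
  have Fh: "continuous_on {0..L} (\<lambda>s. F (h s))"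
    by (rule continuous_on_compose2[OF F continuous_h]) (simp add: path_image_h)
  have Fg: "uniformly_continuous_on {0..1} (\<lambda>t. F (g t))"
    by (intro compact_uniformly_continuous continuous_on_compose2[OF F continuous_g]) (auto simp: path_image_def)
  define \<Phi> where "\<Phi> t = integral {0..S t} G" for t
  have "dist I J \<le> e * (L + 1)" if "0 < e" for e
  proof -
    obtain d1 where d1: "0 < d1" "\<And>t t'. t \<in> {0..1} \<Longrightarrow> t' \<in> {0..1} \<Longrightarrow> dist t' t < d1 \<Longrightarrow> dist (F (g t')) (F (g t)) < e"
      using Fg \<open>0 < e\<close> unfolding uniformly_continuous_on_def by metis
    obtain d2 where d2: "0 < d2" "\<And>p. p tagged_division_of {0..1} \<Longrightarrow> (\<lambda>t. ball t d2) fine p \<Longrightarrow>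
        dist (\<Sum>(t, K)\<in>p. F (g t) * (g (Sup K) - g (Inf K))) I < e"
      using I \<open>0 < e\<close> unfolding has_line_integral_def by meson
    have "gauge (\<lambda>t::real. ball t (min d1 d2))" using d1 d2 by (auto simp: gauge_def)
    then obtain p where p: "p tagged_division_of {0..1}" "(\<lambda>t::real. ball t (min d1 d2)) fine p"
      by (rule fine_division_exists_real)
    have fine2: "(\<lambda>t. ball t d2) fine p" using p(2) unfolding fine_def by fastforce
    have "dist (\<Sum>(t, K)\<in>p. F (g t) * (g (Sup K) - g (Inf K))) J \<le> e * L"
    proof -
      have "J = (\<Sum>(t,K)\<in>p. \<Phi> (Sup K) - \<Phi> (Inf K))"
        using additive_tagged_division_1[OF _ p(1), of \<Phi>] by (simp add: \<Phi>_def J_def S_0 L_def)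
      then have "dist (\<Sum>(t, K)\<in>p. F (g t) * (g (Sup K) - g (Inf K))) J
          = norm (\<Sum>(t,K)\<in>p. F (g t) * (g (Sup K) - g (Inf K)) - (\<Phi> (Sup K) - \<Phi> (Inf K)))"
        by (simp add: dist_norm sum_subtractf case_prod_beta)
      also have "\<dots> \<le> (\<Sum>(t,K)\<in>p. e * (S (Sup K) - S (Inf K)))"
      proof (rule sum_norm_le, clarify)
        fix t K assume tK: "(t, K) \<in> p"
        obtain a b where "K = cbox a b" using tagged_division_ofD(4)[OF p(1) tK] by blast
        then have Kab: "K = {a..b}" by simp
        have t: "t \<in> {a..b}" using tagged_division_ofD(2)[OF p(1) tK] Kab by simp
        have sub: "{a..b} \<subseteq> {0..1}" using tagged_division_ofD(3)[OF p(1) tK] Kab by simp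
        have ab: "0 \<le> a" "a \<le> b" "b \<le> 1" using t sub by auto
        have close: "{a..b} \<subseteq> ball t d1" using p(2) tK Kab unfolding fine_def by fastforce
        have Sab: "0 \<le> S a" "S a \<le> S b" "S b \<le> L" using S_in[of a] S_in[of b] S_mono[of a b] ab by auto
        have contF: "continuous_on {S a..S b} (\<lambda>s. F (h s))" by (rule continuous_on_subset[OF Fh]) (use Sab in auto)
        have cont0: "continuous_on {0..S b} (\<lambda>s. F (h s))" by (rule continuous_on_subset[OF Fh]) (use Sab in auto)
        have "\<Phi> b - \<Phi> a = integral {S a..S b} G"
          using Henstock_Kurzweil_Integration.integral_combine[where a = 0 and c = "S a" and b = "S b" and f = G] weighted_integrable[OF cont0] Sab by (simp add: \<Phi>_def G_def[abs_def] algebra_simps)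
        moreover have "F (g t) * (g b - g a) = integral {S a..S b} (\<lambda>s. F (g t) * u s)"
          using weighted_integral_const[where a = "S a" and b = "S b" and c = "F (g t)"] Sab ab by (auto simp: h_S)
        moreover have "integral {S a..S b} (\<lambda>s. (F (g t) - F (h s)) * u s)
            = integral {S a..S b} (\<lambda>s. F (g t) * u s) - integral {S a..S b} G"
          unfolding left_diff_distrib G_def using Sab
          by (intro integral_diff weighted_integrable contF continuous_on_const) auto
        ultimately have "F (g t) * (g b - g a) - (\<Phi> b - \<Phi> a) = integral {S a..S b} (\<lambda>s. (F (g t) - F (h s)) * u s)"
          by (simp only:)
        also have "norm \<dots> \<le> integral {S a..S b} (\<lambda>_. e)"
        proof (rule weighted_integral_bound)
          fix s assume s: "s \<in> {S a..S b}"
          then have sL: "s \<in> {0..L}" using Sab by auto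
          then have ST: "S (T s) = s" by (simp add: S_T)
          have "T s \<in> {a..b}"
            using s ST S_strict_mono[of "T s" a] S_strict_mono[of b "T s"] T_in[of s] ab by (force simp: not_le[symmetric])
          then show "norm (F (g t) - F (h s)) \<le> e"
            using d1(2)[of "T s" t] close t sub by (force simp: h_def dist_norm dist_commute)
        qed (use Sab contF in \<open>auto intro!: continuous_intros\<close>)
        also have "\<dots> = e * (S b - S a)" using Sab by simp
        finally show "norm (F (g t) * (g (Sup K) - g (Inf K)) - (\<Phi> (Sup K) - \<Phi> (Inf K))) \<le> e * (S (Sup K) - S (Inf K))"
          using ab Kab by simp
      qed
      also have "\<dots> = e * L"
        using additive_tagged_division_1[OF _ p(1), of S] by (simp add: sum_distrib_left[symmetric] case_prod_beta S_0 L_def)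
      finally show ?thesis .
    qed
    moreover have "dist (\<Sum>(t, K)\<in>p. F (g t) * (g (Sup K) - g (Inf K))) I < e" by (rule d2(2)[OF p(1) fine2])
    ultimately show ?thesis
      using dist_triangle[of I J "\<Sum>(t, K)\<in>p. F (g t) * (g (Sup K) - g (Inf K))"] by (simp add: dist_commute algebra_simps)
  qed
  note * = this
  have "dist I J \<le> 0 + e" if "0 < e" for e
    using *[of "e / (L + 1)"] that L_pos by simp
  then have "dist I J \<le> 0" by (rule field_le_epsilon)
  then show ?thesis by (simp add: J_def G_def[abs_def])
qed

end

section \<open>The Cauchy integral\<close>

context unit_speed_curve
begin

definition cauchy_integral :: "(real \<Rightarrow> complex) \<Rightarrow> complex \<Rightarrow> complex" where
  "cauchy_integral F z = integral {0..L} (\<lambda>s. F s / (h s - z) * u s)"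

lemma compact_curve: "compact (h ` {0..L})"
  by (intro compact_continuous_image continuous_h) auto

lemma cauchy_kernel_continuous:
  "continuous_on {0..L} F \<Longrightarrow> z \<notin> h ` {0..L} \<Longrightarrow> continuous_on {0..L} (\<lambda>s. F s / (h s - z))"
  by (intro continuous_intros continuous_h) auto

text \<open>Differentiation under the integral sign. Since the density is merely measurable in \<open>s\<close>, the remainder is
  estimated directly, from \<open>1 / (\<zeta> - w) - 1 / (\<zeta> - z) - (w - z) / (\<zeta> - z)\<^sup>2 = (w - z)\<^sup>2 / ((\<zeta> - w) (\<zeta> - z)\<^sup>2)\<close>.\<close>

lemma cauchy_integral_holomorphic:
  assumes F: "continuous_on {0..L} F"
  shows "cauchy_integral F holomorphic_on - h ` {0..L}"
proof -
  have "open (- h ` {0..L})" using compact_curve compact_imp_closed by blast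
  moreover have "\<exists>D. (cauchy_integral F has_field_derivative D) (at z)" if "z \<in> - h ` {0..L}" for z
  proof -
    have z: "z \<notin> h ` {0..L}" using that by simp
    have "compact (F ` {0..L})" using F by (intro compact_continuous_image) auto
    then obtain M where M: "0 < M" "\<And>s. s \<in> {0..L} \<Longrightarrow> norm (F s) \<le> M"
      using compact_imp_bounded by (metis bounded_pos image_eqI)
    obtain d where d: "0 < d" "\<And>s. s \<in> {0..L} \<Longrightarrow> d \<le> norm (h s - z)"
      using separate_point_closed[OF compact_imp_closed[OF compact_curve] z] by (auto simp: dist_norm norm_minus_commute)
    define D where "D = integral {0..L} (\<lambda>s. F s / (h s - z)\<^sup>2 * u s)"
    define C where "C = M * (2 / d ^ 3) * L"
    have C: "0 < C" using M d L_pos by (simp add: C_def)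
    have est: "norm (cauchy_integral F w - cauchy_integral F z - D * (w - z)) \<le> C * (norm (w - z))\<^sup>2"
      if wz: "norm (w - z) < d / 2" for w
    proof -
      have dw: "d / 2 \<le> norm (h s - w)" if "s \<in> {0..L}" for s
        using d(2)[OF that] wz norm_triangle_ineq[of "h s - w" "w - z"] by simp
      then have w: "w \<notin> h ` {0..L}" using d(1) by (metis image_iff cancel_comm_monoid_add_class.diff_cancel half_gt_zero norm_zero not_less)
      have cont: "continuous_on {0..L} (\<lambda>s. F s / (h s - z)\<^sup>2)"
        using z by (intro continuous_intros F continuous_h) auto
      have int: "(\<lambda>s. F s / (h s - w) * u s) integrable_on {0..L}"
        by (intro weighted_integrable cauchy_kernel_continuous F w) auto
      have int': "(\<lambda>s. F s / (h s - z) * u s) integrable_on {0..L}"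
        by (intro weighted_integrable cauchy_kernel_continuous F z) auto
      have int'': "(\<lambda>s. F s / (h s - z)\<^sup>2 * u s) integrable_on {0..L}"
        by (intro weighted_integrable cont) auto
      have "cauchy_integral F w - cauchy_integral F z - D * (w - z)
          = integral {0..L} (\<lambda>s. F s / (h s - w) * u s - F s / (h s - z) * u s - F s / (h s - z)\<^sup>2 * u s * (w - z))"
        unfolding cauchy_integral_def D_def integral_mult_left[symmetric]
        by (simp only: integral_diff[OF int int'] integral_diff[OF integrable_diff[OF int int'] integrable_on_mult_left[OF int'']])
      also have "\<dots> = integral {0..L} (\<lambda>s. (F s * ((w - z)\<^sup>2 / ((h s - w) * (h s - z)\<^sup>2))) * u s)"
      proof (rule integral_cong)
        fix s assume s: "s \<in> {0..L}"
        have nz: "h s - w \<noteq> 0" "h s - z \<noteq> 0" using off_path[OF w s] off_path[OF z s] by auto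
        have "1 / (h s - w) - 1 / (h s - z) - 1 / (h s - z)\<^sup>2 * (w - z) = (w - z)\<^sup>2 / ((h s - w) * (h s - z)\<^sup>2)"
        proof -
          have "1 / a - 1 / b - 1 / b\<^sup>2 * (b - a) = (b - a)\<^sup>2 / (a * b\<^sup>2)" if "a \<noteq> 0" "b \<noteq> 0" for a b :: complex
            using that by (simp add: field_simps power2_eq_square)
          from this[OF nz] show ?thesis by simp
        qed
        from arg_cong[OF this, of "\<lambda>x. F s * x * u s"]
        show "F s / (h s - w) * u s - F s / (h s - z) * u s - F s / (h s - z)\<^sup>2 * u s * (w - z)
            = F s * ((w - z)\<^sup>2 / ((h s - w) * (h s - z)\<^sup>2)) * u s"
          by (simp add: algebra_simps)
      qed
      also have "norm \<dots> \<le> integral {0..L} (\<lambda>_. M * (2 / d ^ 3 * (norm (w - z))\<^sup>2))"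
      proof (rule weighted_integral_bound)
        show "continuous_on {0..L} (\<lambda>s. F s * ((w - z)\<^sup>2 / ((h s - w) * (h s - z)\<^sup>2)))"
          using w z by (intro continuous_intros F continuous_h) auto
        fix s assume s: "s \<in> {0..L}"
        have pos: "0 < d / 2 * d\<^sup>2" using d(1) by simp
        have le: "d / 2 * d\<^sup>2 \<le> norm (h s - w) * (norm (h s - z))\<^sup>2"
          using d s dw by (intro mult_mono power_mono) auto
        have "(norm (w - z))\<^sup>2 / (norm (h s - w) * (norm (h s - z))\<^sup>2) \<le> (norm (w - z))\<^sup>2 / (d / 2 * d\<^sup>2)"
          by (rule divide_left_mono[OF le _ mult_pos_pos[OF less_le_trans[OF pos le] pos]]) simp
        also have "\<dots> = 2 / d ^ 3 * (norm (w - z))\<^sup>2" by (simp add: power2_eq_square power3_eq_cube ac_simps)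
        finally show "norm (F s * ((w - z)\<^sup>2 / ((h s - w) * (h s - z)\<^sup>2))) \<le> M * (2 / d ^ 3 * (norm (w - z))\<^sup>2)"
          unfolding norm_mult norm_divide norm_power using M(1) M(2)[OF s] by (intro mult_mono) auto
      qed auto
      also have "\<dots> = C * (norm (w - z))\<^sup>2" using L_pos by (simp add: C_def)
      finally show ?thesis .
    qed
    have "(cauchy_integral F has_field_derivative D) (at z)"
      unfolding has_field_derivative_def has_derivative_at_alt
    proof (intro conjI allI impI bounded_linear_mult_right)
      fix e :: real assume "0 < e"
      show "\<exists>d>0. \<forall>w. norm (w - z) < d \<longrightarrow>
          norm (cauchy_integral F w - cauchy_integral F z - D * (w - z)) \<le> e * norm (w - z)"
      proof (intro exI[of _ "min (d / 2) (e / C)"] conjI allI impI)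
        fix w assume w: "norm (w - z) < min (d / 2) (e / C)"
        then have "C * norm (w - z) \<le> e" using C by (simp add: field_simps)
        then have "C * (norm (w - z))\<^sup>2 \<le> e * norm (w - z)"
          by (simp add: power2_eq_square mult_right_mono flip: mult.assoc)
        then show "norm (cauchy_integral F w - cauchy_integral F z - D * (w - z)) \<le> e * norm (w - z)"
          using est[of w] w by simp
      qed (use d C \<open>0 < e\<close> in simp)
    qed
    then show ?thesis by blast
  qed
  ultimately show ?thesis by (simp add: holomorphic_on_open)
qed

text \<open>Adding to \<open>1 / (\<zeta> - z)\<close> the polynomial \<open>\<Sum>n<N. \<zeta> ^ n / z ^ (n + 1)\<close> does not change the integral and leaves the
  kernel \<open>(\<zeta> / z) ^ N / (\<zeta> - z)\<close>, which tends to \<open>0\<close> uniformly on the curve.\<close>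

lemma cauchy_integral_zero_at_infinity:
  assumes F: "continuous_on {0..L} F"
    and moments: "\<And>P :: complex poly. integral {0..L} (\<lambda>s. poly P (h s) * F s * u s) = 0"
    and R: "\<And>s. s \<in> {0..L} \<Longrightarrow> norm (h s) \<le> R" and z: "R < norm z"
  shows "cauchy_integral F z = 0"
proof -
  have "0 \<le> R" using order_trans[OF norm_ge_zero R[of 0]] L_pos by simp
  then have nz: "0 < norm z" "z \<noteq> 0" using z by auto
  have zn: "z \<notin> h ` {0..L}" using R z by force
  have "compact (F ` {0..L})" using F by (intro compact_continuous_image) auto
  then obtain M where M: "0 < M" "\<And>s. s \<in> {0..L} \<Longrightarrow> norm (F s) \<le> M"
    using compact_imp_bounded by (metis bounded_pos image_eqI)
  define q where "q = R / norm z"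
  have q: "0 \<le> q" "q < 1" using nz z \<open>0 \<le> R\<close> by (auto simp: q_def)
  have "norm (cauchy_integral F z) \<le> M / (norm z - R) * L * q ^ N" for N
  proof -
    define P where "P = (\<Sum>n<N. monom (1 / z ^ Suc n) n)"
    have P: "poly P w = (\<Sum>n<N. (w / z) ^ n) / z" for w
      by (simp add: P_def poly_sum poly_monom sum_divide_distrib power_divide mult.commute)
    have cP: "continuous_on {0..L} (\<lambda>s. poly P (h s) * F s)"
      by (intro continuous_intros F continuous_h)
    have "cauchy_integral F z = integral {0..L} (\<lambda>s. F s / (h s - z) * u s) + integral {0..L} (\<lambda>s. poly P (h s) * F s * u s)"
      using moments[of P] by (simp add: cauchy_integral_def)
    also have "\<dots> = integral {0..L} (\<lambda>s. F s / (h s - z) * u s + poly P (h s) * F s * u s)"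
      by (intro integral_add[symmetric] weighted_integrable cauchy_kernel_continuous F zn cP) auto
    also have "\<dots> = integral {0..L} (\<lambda>s. (F s * ((h s / z) ^ N / (h s - z))) * u s)"
    proof (rule integral_cong)
      fix s assume s: "s \<in> {0..L}"
      have ne: "h s \<noteq> z" by (rule off_path[OF zn s])
      have "(1 - h s / z) * (\<Sum>n<N. (h s / z) ^ n) = 1 - (h s / z) ^ N"
        by (rule one_diff_power_eq[symmetric])
      moreover have "1 - h s / z = (z - h s) / z" using nz by (simp add: field_simps)
      ultimately have "(z - h s) * poly P (h s) = 1 - (h s / z) ^ N" by (simp add: P)
      then have "(h s - z) * (1 / (h s - z) + poly P (h s)) = (h s / z) ^ N"
        using ne by (simp add: algebra_simps)
      then have "1 / (h s - z) + poly P (h s) = (h s / z) ^ N / (h s - z)"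
        using ne by (simp add: nonzero_eq_divide_eq mult.commute)
      from arg_cong[OF this, of "\<lambda>x. F s * x * u s"]
      show "F s / (h s - z) * u s + poly P (h s) * F s * u s = F s * ((h s / z) ^ N / (h s - z)) * u s"
        by (simp add: algebra_simps)
    qed
    also have "norm \<dots> \<le> integral {0..L} (\<lambda>_. M * (q ^ N / (norm z - R)))"
    proof (rule weighted_integral_bound)
      show "continuous_on {0..L} (\<lambda>s. F s * ((h s / z) ^ N / (h s - z)))"
        using zn nz by (intro continuous_intros F continuous_h) auto
      fix s assume s: "s \<in> {0..L}"
      have "norm (h s / z) \<le> q" using R[OF s] nz by (simp add: q_def norm_divide divide_right_mono)
      moreover have "norm z - R \<le> norm (h s - z)"
        using R[OF s] norm_triangle_ineq2[of z "h s"] by (simp add: norm_minus_commute)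
      ultimately have "norm (h s / z) ^ N / norm (h s - z) \<le> q ^ N / (norm z - R)"
        using z q(1) by (intro frac_le power_mono) auto
      then show "norm (F s * ((h s / z) ^ N / (h s - z))) \<le> M * (q ^ N / (norm z - R))"
        unfolding norm_mult[of "F s"] norm_divide[of "_ ^ N"] norm_power using M(1) M(2)[OF s] by (intro mult_mono) auto
    qed auto
    also have "\<dots> = M / (norm z - R) * L * q ^ N" using L_pos by simp
    finally show ?thesis .
  qed
  moreover have "(\<lambda>N. M / (norm z - R) * L * q ^ N) \<longlonglongrightarrow> 0"
    using q by (intro tendsto_mult_right_zero LIMSEQ_power_zero) auto
  ultimately have "norm (cauchy_integral F z) \<le> 0"
    by (intro LIMSEQ_le_const[where X = "\<lambda>N. M / (norm z - R) * L * q ^ N"]) auto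
  then show ?thesis by simp
qed

lemma cauchy_integral_zero_outside:
  assumes F: "continuous_on {0..L} F"
    and moments: "\<And>P :: complex poly. integral {0..L} (\<lambda>s. poly P (h s) * F s * u s) = 0"
    and z: "z \<in> outside (h ` {0..L})"
  shows "cauchy_integral F z = 0"
proof -
  obtain R where R: "0 < R" "\<And>s. s \<in> {0..L} \<Longrightarrow> norm (h s) \<le> R"
    using compact_imp_bounded[OF compact_curve] by (metis bounded_pos image_eqI)
  have sub: "- cball 0 R \<subseteq> outside (h ` {0..L})"
    using R(2) by (intro outside_subset_convex) auto
  have far: "of_real (R + 1) \<in> - cball (0::complex) R" using R(1) by simp
  show ?thesis
  proof (rule analytic_continuation[of "cauchy_integral F" "outside (h ` {0..L})" "- cball 0 R" "of_real (R + 1)" z])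
    show "cauchy_integral F holomorphic_on outside (h ` {0..L})"
      by (rule holomorphic_on_subset[OF cauchy_integral_holomorphic[OF F]])
        (use outside_no_overlap in blast)
    show "open (outside (h ` {0..L}))" by (intro open_outside compact_imp_closed compact_curve)
    show "connected (outside (h ` {0..L}))" by (intro connected_outside compact_imp_bounded compact_curve) simp
    show "of_real (R + 1) islimpt - cball (0::complex) R"
      by (rule interior_limit_point) (use far in \<open>simp add: interior_open open_Compl\<close>)
    show "cauchy_integral F w = 0" if "w \<in> - cball 0 R" for w
      using that by (intro cauchy_integral_zero_at_infinity[OF F moments R(2)]) auto
  qed (use sub far z in auto)
qed

end

section \<open>The curve near a point with a tangent\<close>

context unit_speed_curve
begin

text \<open>Near \<open>s\<^sub>0\<close> the curve is \<open>h s\<^sub>0 + (s - s\<^sub>0) v\<close> up to a small relative error, and a vector \<open>w\<close> making an angle bounded away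
  from \<open>0\<close> with the tangent satisfies \<open>\<bar>x v - w\<bar>\<^sup>2 \<ge> (1 - \<sigma>) (x\<^sup>2 + \<bar>w\<bar>\<^sup>2)\<close>. The other points of the curve keep a
  positive distance from \<open>h s\<^sub>0\<close>, which is comparable with the right-hand side because that is bounded there; so
  one constant serves for the whole curve.\<close>

lemma cone_estimate:
  assumes s0: "s\<^sub>0 \<in> {0..L}" and der: "(h has_vector_derivative v) (at s\<^sub>0)" and v: "norm v = 1"
    and inj: "\<And>s. s \<in> {0..L} \<Longrightarrow> s \<noteq> s\<^sub>0 \<Longrightarrow> h s \<noteq> h s\<^sub>0" and \<sigma>: "0 \<le> \<sigma>" "\<sigma> < 1"
  obtains c r where "0 < c" "0 < r"
    "\<And>s w. s \<in> {0..L} \<Longrightarrow> norm w < r \<Longrightarrow> \<bar>w \<bullet> v\<bar> \<le> \<sigma> * norm w \<Longrightarrow>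
       c * sqrt ((norm w)\<^sup>2 + (s - s\<^sub>0)\<^sup>2) \<le> norm (h s - (h s\<^sub>0 + w))"
proof -
  define q where "q = sqrt (1 - \<sigma>)"
  have q: "0 < q" "q\<^sup>2 = 1 - \<sigma>" using \<sigma> by (auto simp: q_def)
  have "\<exists>d>0. \<forall>y. norm (y - s\<^sub>0) < d \<longrightarrow> norm (h y - h s\<^sub>0 - (y - s\<^sub>0) *\<^sub>R v) \<le> q / 2 * norm (y - s\<^sub>0)"
    using der[unfolded has_vector_derivative_def has_derivative_at_alt, THEN conjunct2, rule_format, of "q / 2"] q by simp
  then obtain \<eta> where \<eta>: "0 < \<eta>"
      "\<And>y. norm (y - s\<^sub>0) < \<eta> \<Longrightarrow> norm (h y - h s\<^sub>0 - (y - s\<^sub>0) *\<^sub>R v) \<le> q / 2 * norm (y - s\<^sub>0)" by auto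
  have near: "q / 2 * sqrt ((norm w)\<^sup>2 + (s - s\<^sub>0)\<^sup>2) \<le> norm (h s - (h s\<^sub>0 + w))"
    if w: "\<bar>w \<bullet> v\<bar> \<le> \<sigma> * norm w" and s: "\<bar>s - s\<^sub>0\<bar> < \<eta>" for s w
  proof -
    define x where "x = s - s\<^sub>0"
    define R where "R = sqrt ((norm w)\<^sup>2 + x\<^sup>2)"
    have xR: "\<bar>x\<bar> \<le> R" unfolding R_def by (rule real_le_rsqrt) simp
    have "\<bar>x * (v \<bullet> w)\<bar> \<le> \<bar>x\<bar> * (\<sigma> * norm w)"
      using w by (simp add: abs_mult mult_left_mono inner_commute)
    then have "2 * (x * (v \<bullet> w)) \<le> \<sigma> * (2 * (\<bar>x\<bar> * norm w))" by (simp add: algebra_simps abs_le_iff)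
    also have "2 * (\<bar>x\<bar> * norm w) \<le> (norm w)\<^sup>2 + x\<^sup>2"
      using zero_le_power2[of "\<bar>x\<bar> - norm w"] by (simp add: power2_diff)
    finally have "2 * (x * (v \<bullet> w)) \<le> \<sigma> * ((norm w)\<^sup>2 + x\<^sup>2)" using \<sigma>(1) by (simp add: mult_left_mono)
    moreover have "(norm (x *\<^sub>R v - w))\<^sup>2 = x\<^sup>2 * (norm v)\<^sup>2 - 2 * (x * (v \<bullet> w)) + (norm w)\<^sup>2"
      unfolding power2_norm_eq_inner by (simp add: inner_diff_left inner_diff_right inner_commute power2_eq_square)
    ultimately have "(q * R)\<^sup>2 \<le> (norm (x *\<^sub>R v - w))\<^sup>2"
      by (simp add: power_mult_distrib q(2) R_def v algebra_simps)
    then have "q * R \<le> norm (x *\<^sub>R v - w)" by (rule power2_le_imp_le) simp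
    also have "x *\<^sub>R v - w = (h s - (h s\<^sub>0 + w)) - (h s - h s\<^sub>0 - (s - s\<^sub>0) *\<^sub>R v)" by (simp add: x_def)
    also have "norm \<dots> \<le> norm (h s - (h s\<^sub>0 + w)) + q / 2 * \<bar>x\<bar>"
    proof (rule order_trans[OF norm_triangle_ineq4 add_left_mono])
      show "norm (h s - h s\<^sub>0 - (s - s\<^sub>0) *\<^sub>R v) \<le> q / 2 * \<bar>x\<bar>"
        using \<eta>(2)[of s] s by (simp only: x_def real_norm_def)
    qed
    also have "\<dots> \<le> norm (h s - (h s\<^sub>0 + w)) + q / 2 * R" using xR q by simp
    finally show ?thesis by (simp add: R_def x_def)
  qed
  define K where "K = h ` ({0..L} - ball s\<^sub>0 \<eta>)"
  have "compact K" unfolding K_def by (intro compact_continuous_image continuous_h compact_diff) auto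
  moreover have "h s\<^sub>0 \<notin> K" using inj \<eta>(1) unfolding K_def by force
  ultimately obtain m where m: "0 < m" "\<And>z. z \<in> K \<Longrightarrow> m \<le> dist (h s\<^sub>0) z"
    using separate_point_closed[OF compact_imp_closed] by metis
  define B where "B = sqrt (1 + L\<^sup>2)"
  have B: "0 < B" by (simp add: B_def add_pos_nonneg)
  define c where "c = min (q / 2) (m / (2 * B))"
  show ?thesis
  proof (rule that[of c "min 1 (m / 2)"])
    show "0 < c" "0 < min 1 (m / 2)" using q m B by (auto simp: c_def)
    fix s w assume s: "s \<in> {0..L}" and w: "norm w < min 1 (m / 2)" "\<bar>w \<bullet> v\<bar> \<le> \<sigma> * norm w"
    show "c * sqrt ((norm w)\<^sup>2 + (s - s\<^sub>0)\<^sup>2) \<le> norm (h s - (h s\<^sub>0 + w))"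
    proof (cases "\<bar>s - s\<^sub>0\<bar> < \<eta>")
      case True
      have "c * sqrt ((norm w)\<^sup>2 + (s - s\<^sub>0)\<^sup>2) \<le> q / 2 * sqrt ((norm w)\<^sup>2 + (s - s\<^sub>0)\<^sup>2)"
        by (intro mult_right_mono) (auto simp: c_def)
      also have "\<dots> \<le> norm (h s - (h s\<^sub>0 + w))" by (rule near[OF w(2) True])
      finally show ?thesis .
    next
      case False
      have "(norm w)\<^sup>2 \<le> 1" using w(1) by (simp add: power_le_one)
      moreover have "(s - s\<^sub>0)\<^sup>2 \<le> L\<^sup>2" using s s0 by (intro abs_le_square_iff[THEN iffD1]) auto
      ultimately have "sqrt ((norm w)\<^sup>2 + (s - s\<^sub>0)\<^sup>2) \<le> B" by (simp add: B_def)
      then have "c * sqrt ((norm w)\<^sup>2 + (s - s\<^sub>0)\<^sup>2) \<le> m / (2 * B) * B"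
        using m B by (intro mult_mono) (auto simp: c_def)
      also have "\<dots> = m / 2" using B by simp
      also have "\<dots> \<le> norm (h s - h s\<^sub>0) - norm w"
        using m(2)[of "h s"] s False w(1) by (auto simp: K_def dist_norm norm_minus_commute)
      also have "\<dots> \<le> norm (h s - (h s\<^sub>0 + w))"
        using norm_triangle_ineq2[of "h s - h s\<^sub>0" w] by (simp add: algebra_simps)
      finally show ?thesis .
    qed
  qed
qed

text \<open>Outside \<open>[s\<^sub>0 - \<eta>, s\<^sub>0 + \<eta>]\<close> the integrals at the two points \<open>h s\<^sub>0 \<plusminus> \<i> \<rho> v\<close> have a common limit as \<open>\<rho>\<close> tends to \<open>0\<close>. On
  the middle arc, seen from either point, the curve avoids the ray that starts there and points away
  from the tangent. So both integrals are increments of logarithms, but of branches cut along opposite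
  rays; in the limit the branches differ by \<open>\<i> \<pi>\<close> at the end and by \<open>- \<i> \<pi>\<close> at the start of the arc.\<close>

lemma kernel_jump:
  assumes s0: "s\<^sub>0 \<in> {0<..<L}" and der: "(h has_vector_derivative v) (at s\<^sub>0)" and v: "norm v = 1"
    and inj: "\<And>s. s \<in> {0..L} \<Longrightarrow> s \<noteq> s\<^sub>0 \<Longrightarrow> h s \<noteq> h s\<^sub>0"
  shows "((\<lambda>\<rho>. integral {0..L} (\<lambda>s. 1 / (h s - (h s\<^sub>0 + of_real \<rho> * (\<i> * v))) * u s)
              - integral {0..L} (\<lambda>s. 1 / (h s - (h s\<^sub>0 - of_real \<rho> * (\<i> * v))) * u s))
          \<longlongrightarrow> 2 * of_real pi * \<i>) (at_right 0)"
proof -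
  define \<zeta> where "\<zeta> = h s\<^sub>0"
  have v0: "v \<noteq> 0" using v by auto
  have s0': "s\<^sub>0 \<in> {0..L}" using s0 by auto
  have "\<exists>d>0. \<forall>y. norm (y - s\<^sub>0) < d \<longrightarrow> norm (h y - h s\<^sub>0 - (y - s\<^sub>0) *\<^sub>R v) \<le> 1 / 2 * norm (y - s\<^sub>0)"
    using der[unfolded has_vector_derivative_def has_derivative_at_alt, THEN conjunct2, rule_format, of "1 / 2"] by simp
  then obtain \<eta>' where \<eta>': "0 < \<eta>'"
      "\<And>y. norm (y - s\<^sub>0) < \<eta>' \<Longrightarrow> norm (h y - h s\<^sub>0 - (y - s\<^sub>0) *\<^sub>R v) \<le> 1 / 2 * norm (y - s\<^sub>0)" by auto
  define \<eta> where "\<eta> = min (\<eta>' / 2) (min s\<^sub>0 (L - s\<^sub>0))"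
  have \<eta>: "0 < \<eta>" "\<eta> < \<eta>'" "0 \<le> s\<^sub>0 - \<eta>" "s\<^sub>0 + \<eta> \<le> L" using \<eta>'(1) s0 by (auto simp: \<eta>_def)
  \<comment> \<open>The curve in coordinates with \<open>h s\<^sub>0\<close> at the origin and the tangent along the real axis.\<close>
  define a where "a s = (h s - \<zeta>) / v" for s
  have a: "\<bar>Re (a s) - (s - s\<^sub>0)\<bar> \<le> \<bar>s - s\<^sub>0\<bar> / 2"
    if "s \<in> {s\<^sub>0-\<eta>..s\<^sub>0+\<eta>}" for s
  proof -
    have "a s - of_real (s - s\<^sub>0) = (h s - h s\<^sub>0 - (s - s\<^sub>0) *\<^sub>R v) / v"
      using v0 by (simp add: a_def \<zeta>_def scaleR_conv_of_real field_simps)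
    then have "norm (a s - of_real (s - s\<^sub>0)) = norm (h s - h s\<^sub>0 - (s - s\<^sub>0) *\<^sub>R v)"
      using v by (simp add: norm_divide)
    also have "\<dots> \<le> \<bar>s - s\<^sub>0\<bar> / 2" using \<eta>'(2)[of s] that \<eta>(2) by auto
    finally have "norm (a s - of_real (s - s\<^sub>0)) \<le> \<bar>s - s\<^sub>0\<bar> / 2" .
    then show "\<bar>Re (a s) - (s - s\<^sub>0)\<bar> \<le> \<bar>s - s\<^sub>0\<bar> / 2"
      using abs_Re_le_cmod[of "a s - of_real (s - s\<^sub>0)"] by simp
  qed
  define p where "p = a (s\<^sub>0 + \<eta>)"
  define n where "n = a (s\<^sub>0 - \<eta>)"
  have "\<bar>Re p - \<eta>\<bar> \<le> \<eta> / 2" "\<bar>Re n + \<eta>\<bar> \<le> \<eta> / 2"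
    using a[of "s\<^sub>0 + \<eta>"] a[of "s\<^sub>0 - \<eta>"] \<eta>(1) by (auto simp: p_def n_def)
  then have p: "0 < Re p" and n: "Re n < 0" using \<eta>(1) by linarith+
  obtain c r where cr: "0 < c" "0 < r"
    "\<And>s w. s \<in> {0..L} \<Longrightarrow> norm w < r \<Longrightarrow> \<bar>w \<bullet> v\<bar> \<le> 0 * norm w \<Longrightarrow>
       c * sqrt ((norm w)\<^sup>2 + (s - s\<^sub>0)\<^sup>2) \<le> norm (h s - (h s\<^sub>0 + w))"
    by (rule cone_estimate[OF s0' der v inj, of 0]) auto
  have orth: "(of_real \<rho> * (\<i> * v)) \<bullet> v = 0" for \<rho> by (simp add: inner_complex_def)
  have low: "c * sqrt (\<rho>\<^sup>2 + (s - s\<^sub>0)\<^sup>2) \<le> norm (h s - (\<zeta> + of_real \<rho> * (\<i> * v)))"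
    if "s \<in> {0..L}" "\<bar>\<rho>\<bar> < r" for s \<rho>
    using cr(3)[of s "of_real \<rho> * (\<i> * v)"] that orth[of \<rho>] v by (simp add: \<zeta>_def norm_mult)
  have off: "\<zeta> + of_real \<rho> * (\<i> * v) \<notin> h ` {0..L}" if "\<bar>\<rho>\<bar> < r" "\<rho> \<noteq> 0" for \<rho>
  proof
    assume "\<zeta> + of_real \<rho> * (\<i> * v) \<in> h ` {0..L}"
    then obtain s where s: "s \<in> {0..L}" "h s = \<zeta> + of_real \<rho> * (\<i> * v)" by force
    have "0 < c * sqrt (\<rho>\<^sup>2 + (s - s\<^sub>0)\<^sup>2)" using cr(1) that by (simp add: add_pos_nonneg)
    then show False using low[OF s(1) that(1)] s(2) by simp
  qed
  define W where "W \<rho> b c = integral {b..c} (\<lambda>s. 1 / (h s - (\<zeta> + of_real \<rho> * (\<i> * v))) * u s)" for \<rho> b c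
  have far: "((\<lambda>\<rho>. W \<rho> b c' - W (- \<rho>) b c') \<longlongrightarrow> 0) (at_right 0)"
    if bc: "0 \<le> b" "b \<le> c'" "c' \<le> L" "\<And>s. s \<in> {b..c'} \<Longrightarrow> \<eta> \<le> \<bar>s - s\<^sub>0\<bar>" for b c'
  proof (rule Lim_null_comparison)
    show "((\<lambda>\<rho>. (c' - b) * (2 / (c * \<eta>)\<^sup>2) * \<rho>) \<longlongrightarrow> 0) (at_right 0)"
      by (intro tendsto_eq_intros) auto
    have "norm (W \<rho> b c' - W (- \<rho>) b c') \<le> (c' - b) * (2 / (c * \<eta>)\<^sup>2) * \<rho>" if \<rho>: "0 < \<rho>" "\<rho> < r" for \<rho>
    proof -
      have o1: "\<zeta> + of_real \<rho> * (\<i> * v) \<notin> h ` {0..L}" and o2: "\<zeta> + of_real (-\<rho>) * (\<i> * v) \<notin> h ` {0..L}"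
        using off[of \<rho>] off[of "-\<rho>"] \<rho> by auto
      have c1: "continuous_on {b..c'} (\<lambda>s. 1 / (h s - (\<zeta> + of_real \<rho> * (\<i> * v))))"
        by (rule continuous_on_subset[OF kernel_continuous[OF o1]]) (use bc in auto)
      have c2: "continuous_on {b..c'} (\<lambda>s. 1 / (h s - (\<zeta> + of_real (-\<rho>) * (\<i> * v))))"
        by (rule continuous_on_subset[OF kernel_continuous[OF o2]]) (use bc in auto)
      have "W \<rho> b c' - W (- \<rho>) b c' = integral {b..c'} (\<lambda>s. (1 / (h s - (\<zeta> + of_real \<rho> * (\<i> * v)))
          - 1 / (h s - (\<zeta> + of_real (-\<rho>) * (\<i> * v)))) * u s)"
        unfolding W_def left_diff_distrib
        by (intro integral_diff[symmetric] weighted_integrable c1 c2 bc)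
      also have "norm \<dots> \<le> integral {b..c'} (\<lambda>_. 2 * \<rho> / (c * \<eta>)\<^sup>2)"
      proof (rule weighted_integral_bound)
        fix s assume s: "s \<in> {b..c'}"
        then have sL: "s \<in> {0..L}" using bc by auto
        define A where "A = h s - (\<zeta> + of_real \<rho> * (\<i> * v))"
        define B where "B = h s - (\<zeta> + of_real (-\<rho>) * (\<i> * v))"
        have "c * \<eta> \<le> c * sqrt (\<rho>\<^sup>2 + (s - s\<^sub>0)\<^sup>2)"
          using bc(4)[OF s] cr(1) by (intro mult_left_mono order_trans[OF _ real_sqrt_ge_abs2]) auto
        then have AB: "c * \<eta> \<le> norm A" "c * \<eta> \<le> norm B"
          using low[OF sL, of \<rho>] low[OF sL, of "-\<rho>"] \<rho> by (auto simp: A_def B_def)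
        have pos: "0 < c * \<eta>" using cr \<eta> by simp
        then have nz: "A \<noteq> 0" "B \<noteq> 0" using AB by auto
        have "1 / A - 1 / B = (B - A) / (A * B)" using nz by (simp add: field_simps)
        also have "B - A = of_real (2 * \<rho>) * (\<i> * v)" by (simp add: A_def B_def)
        finally have "norm (1 / A - 1 / B) = 2 * \<rho> / (norm A * norm B)"
          using v \<rho> by (simp add: norm_divide norm_mult)
        also have "\<dots> \<le> 2 * \<rho> / (c * \<eta>)\<^sup>2"
          using AB pos \<rho> cr(1) \<eta>(1) unfolding power2_eq_square by (intro divide_left_mono mult_mono mult_pos_pos) (auto simp: nz)
        finally show "norm (1 / (h s - (\<zeta> + of_real \<rho> * (\<i> * v))) - 1 / (h s - (\<zeta> + of_real (-\<rho>) * (\<i> * v))))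
            \<le> 2 * \<rho> / (c * \<eta>)\<^sup>2" by (simp add: A_def B_def)
      qed (use c1 c2 bc in \<open>auto intro!: continuous_on_diff\<close>)
      also have "\<dots> = (c' - b) * (2 / (c * \<eta>)\<^sup>2) * \<rho>" using bc by simp
      finally show ?thesis .
    qed
    then show "\<forall>\<^sub>F \<rho> in at_right 0. norm (W \<rho> b c' - W (- \<rho>) b c') \<le> (c' - b) * (2 / (c * \<eta>)\<^sup>2) * \<rho>"
      using cr(2) by (auto simp: eventually_at_right_field)
  qed
  have mid: "((\<lambda>\<rho>. W \<rho> (s\<^sub>0 - \<eta>) (s\<^sub>0 + \<eta>) - W (- \<rho>) (s\<^sub>0 - \<eta>) (s\<^sub>0 + \<eta>)) \<longlongrightarrow> 2 * of_real pi * \<i>) (at_right 0)"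
  proof -
    have notneg: "k * a s + of_real \<rho> \<notin> \<real>\<^sub>\<le>\<^sub>0" if "k = \<i> \<or> k = - \<i>" "0 < \<rho>" "s \<in> {s\<^sub>0-\<eta>..s\<^sub>0+\<eta>}" for k \<rho> s
    proof
      assume neg: "k * a s + of_real \<rho> \<in> \<real>\<^sub>\<le>\<^sub>0"
      then have "Re (a s) = 0" using that(1) by (auto simp: complex_nonpos_Reals_iff)
      then have "\<bar>s - s\<^sub>0\<bar> \<le> \<bar>s - s\<^sub>0\<bar> / 2"
        using a[OF that(3)] by (simp add: abs_minus_commute)
      then have "s = s\<^sub>0" by simp
      then have "a s = 0" by (simp add: a_def \<zeta>_def)
      then show False using neg that(2) by (simp add: complex_nonpos_Reals_iff)
    qed
    have eq: "W \<rho> (s\<^sub>0 - \<eta>) (s\<^sub>0 + \<eta>) = Ln (\<i> * p + of_real \<rho>) - Ln (\<i> * n + of_real \<rho>)"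
         "W (- \<rho>) (s\<^sub>0 - \<eta>) (s\<^sub>0 + \<eta>) = Ln (- \<i> * p + of_real \<rho>) - Ln (- \<i> * n + of_real \<rho>)"
      if \<rho>: "0 < \<rho>" "\<rho> < r" for \<rho>
    proof -
      have o1: "\<zeta> + of_real \<rho> * (\<i> * v) \<notin> h ` {0..L}" and o2: "\<zeta> + of_real (-\<rho>) * (\<i> * v) \<notin> h ` {0..L}"
        using off[of \<rho>] off[of "-\<rho>"] \<rho> by auto
      have e1: "\<i> / v * (h s - (\<zeta> + of_real \<rho> * (\<i> * v))) = \<i> * a s + of_real \<rho>" for s
        using v0 by (simp add: a_def field_simps)
      have e2: "- \<i> / v * (h s - (\<zeta> + of_real (-\<rho>) * (\<i> * v))) = - \<i> * a s + of_real \<rho>" for s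
        using v0 by (simp add: a_def field_simps)
      have "W \<rho> (s\<^sub>0 - \<eta>) (s\<^sub>0 + \<eta>) = Ln (\<i> / v * (h (s\<^sub>0 + \<eta>) - (\<zeta> + of_real \<rho> * (\<i> * v))))
          - Ln (\<i> / v * (h (s\<^sub>0 - \<eta>) - (\<zeta> + of_real \<rho> * (\<i> * v))))"
        unfolding W_def
        by (rule log_increment[OF o1]) (use \<eta> notneg[of \<i> \<rho>] \<rho> in \<open>auto simp only: e1\<close>)
      then show "W \<rho> (s\<^sub>0 - \<eta>) (s\<^sub>0 + \<eta>) = Ln (\<i> * p + of_real \<rho>) - Ln (\<i> * n + of_real \<rho>)"
        by (simp only: e1 p_def n_def)
      have "W (-\<rho>) (s\<^sub>0 - \<eta>) (s\<^sub>0 + \<eta>) = Ln (- \<i> / v * (h (s\<^sub>0 + \<eta>) - (\<zeta> + of_real (-\<rho>) * (\<i> * v))))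
          - Ln (- \<i> / v * (h (s\<^sub>0 - \<eta>) - (\<zeta> + of_real (-\<rho>) * (\<i> * v))))"
        unfolding W_def
        by (rule log_increment[OF o2]) (use \<eta> notneg[of "-\<i>" \<rho>] \<rho> in \<open>auto simp only: e2\<close>)
      then show "W (-\<rho>) (s\<^sub>0 - \<eta>) (s\<^sub>0 + \<eta>) = Ln (- \<i> * p + of_real \<rho>) - Ln (- \<i> * n + of_real \<rho>)"
        by (simp only: e2 p_def n_def)
    qed
    have lim: "((\<lambda>\<rho>. Ln (z + of_real \<rho>)) \<longlongrightarrow> Ln z) (at_right 0)" if "Im z \<noteq> 0" for z
    proof (rule tendsto_Ln)
      show "((\<lambda>\<rho>. z + of_real \<rho>) \<longlongrightarrow> z) (at_right 0)"
        by (intro tendsto_eq_intros) (auto intro!: tendsto_of_real[where a = "0::real", simplified])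
      show "z \<notin> \<real>\<^sub>\<le>\<^sub>0" using that by (auto simp: complex_nonpos_Reals_iff)
    qed
    have "((\<lambda>\<rho>. (Ln (\<i> * p + of_real \<rho>) - Ln (\<i> * n + of_real \<rho>)) - (Ln (- \<i> * p + of_real \<rho>) - Ln (- \<i> * n + of_real \<rho>)))
        \<longlongrightarrow> (Ln (\<i> * p) - Ln (\<i> * n)) - (Ln (- \<i> * p) - Ln (- \<i> * n))) (at_right 0)"
      by (intro tendsto_diff lim) (use p n in auto)
    moreover have "(Ln (\<i> * p) - Ln (\<i> * n)) - (Ln (- \<i> * p) - Ln (- \<i> * n)) = 2 * of_real pi * \<i>"
    proof -
      have "\<i> * p \<noteq> 0" "\<i> * n \<noteq> 0" using p n by auto
      then have "Ln (- (\<i> * p)) = Ln (\<i> * p) - \<i> * pi" "Ln (- (\<i> * n)) = Ln (\<i> * n) + \<i> * pi"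
        using p n by (simp_all add: Ln_minus)
      then show ?thesis by (simp add: algebra_simps)
    qed
    moreover have "\<forall>\<^sub>F \<rho> in at_right 0. (Ln (\<i> * p + of_real \<rho>) - Ln (\<i> * n + of_real \<rho>)) - (Ln (- \<i> * p + of_real \<rho>) - Ln (- \<i> * n + of_real \<rho>))
        = W \<rho> (s\<^sub>0 - \<eta>) (s\<^sub>0 + \<eta>) - W (- \<rho>) (s\<^sub>0 - \<eta>) (s\<^sub>0 + \<eta>)"
      unfolding eventually_at_right_field using eq cr(2) by (intro exI[of _ r]) simp
    ultimately show ?thesis by (simp add: tendsto_cong[symmetric] del: minus_mult_left)
  qed
  have split: "W \<rho> 0 L = W \<rho> 0 (s\<^sub>0 - \<eta>) + W \<rho> (s\<^sub>0 - \<eta>) (s\<^sub>0 + \<eta>) + W \<rho> (s\<^sub>0 + \<eta>) L" if "\<bar>\<rho>\<bar> < r" "\<rho> \<noteq> 0" for \<rho>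
  proof -
    have int: "(\<lambda>s. 1 / (h s - (\<zeta> + of_real \<rho> * (\<i> * v))) * u s) integrable_on {0..L}"
      by (intro weighted_integrable kernel_continuous off that) auto
    have int': "(\<lambda>s. 1 / (h s - (\<zeta> + of_real \<rho> * (\<i> * v))) * u s) integrable_on {0..s\<^sub>0+\<eta>}"
      by (rule integrable_on_subinterval[OF int]) (use \<eta> in auto)
    have "W \<rho> 0 (s\<^sub>0 + \<eta>) + W \<rho> (s\<^sub>0 + \<eta>) L = W \<rho> 0 L"
      unfolding W_def by (rule Henstock_Kurzweil_Integration.integral_combine) (use \<eta> s0 int in auto)
    moreover have "W \<rho> 0 (s\<^sub>0 - \<eta>) + W \<rho> (s\<^sub>0 - \<eta>) (s\<^sub>0 + \<eta>) = W \<rho> 0 (s\<^sub>0 + \<eta>)"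
      unfolding W_def by (rule Henstock_Kurzweil_Integration.integral_combine) (use \<eta> s0 int' in auto)
    ultimately show ?thesis by simp
  qed
  have "((\<lambda>\<rho>. (W \<rho> 0 (s\<^sub>0 - \<eta>) - W (-\<rho>) 0 (s\<^sub>0 - \<eta>)) + (W \<rho> (s\<^sub>0 - \<eta>) (s\<^sub>0 + \<eta>) - W (-\<rho>) (s\<^sub>0 - \<eta>) (s\<^sub>0 + \<eta>))
      + (W \<rho> (s\<^sub>0 + \<eta>) L - W (-\<rho>) (s\<^sub>0 + \<eta>) L)) \<longlongrightarrow> 0 + 2 * of_real pi * \<i> + 0) (at_right 0)"
    by (intro tendsto_add mid far) (use \<eta> in auto)
  moreover have "\<forall>\<^sub>F \<rho> in at_right 0. (W \<rho> 0 (s\<^sub>0 - \<eta>) - W (-\<rho>) 0 (s\<^sub>0 - \<eta>)) + (W \<rho> (s\<^sub>0 - \<eta>) (s\<^sub>0 + \<eta>) - W (-\<rho>) (s\<^sub>0 - \<eta>) (s\<^sub>0 + \<eta>))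
      + (W \<rho> (s\<^sub>0 + \<eta>) L - W (-\<rho>) (s\<^sub>0 + \<eta>) L) = W \<rho> 0 L - W (-\<rho>) 0 L"
    unfolding eventually_at_right_field using split cr(2) by (intro exI[of _ r]) (simp add: algebra_simps)
  ultimately have "((\<lambda>\<rho>. W \<rho> 0 L - W (-\<rho>) 0 L) \<longlongrightarrow> 2 * of_real pi * \<i>) (at_right 0)"
    by (simp add: tendsto_cong)
  then show ?thesis by (simp add: W_def \<zeta>_def)
qed

end

lemma poisson_kernel_integral:
  fixes t x0 :: real
  assumes "0 < t" "0 \<le> L"
  shows "(\<lambda>x. t / (t\<^sup>2 + (x - x0)\<^sup>2)) integrable_on {0..L}"
    "integral {0..L} (\<lambda>x. t / (t\<^sup>2 + (x - x0)\<^sup>2)) \<le> pi"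
proof -
  have int: "((\<lambda>x. t / (t\<^sup>2 + (x - x0)\<^sup>2)) has_integral (arctan ((L - x0) / t) - arctan ((0 - x0) / t))) {0..L}"
  proof (rule fundamental_theorem_of_calculus[OF assms(2)])
    fix x assume "x \<in> {0..L}"
    have "t\<^sup>2 + (x - x0)\<^sup>2 \<noteq> 0" using assms(1) by (simp add: add_pos_nonneg less_imp_neq[symmetric])
    then have "inverse (1 + ((x - x0) / t)\<^sup>2) * (1 / t) = t / (t\<^sup>2 + (x - x0)\<^sup>2)"
      using assms(1) by (simp add: field_simps power2_eq_square)
    moreover have "((\<lambda>x. arctan ((x - x0) / t)) has_real_derivative inverse (1 + ((x - x0) / t)\<^sup>2) * (1 / t)) (at x within {0..L})"
      using assms(1) by (auto intro!: derivative_eq_intros simp: field_simps)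
    ultimately show "((\<lambda>x. arctan ((x - x0) / t)) has_vector_derivative t / (t\<^sup>2 + (x - x0)\<^sup>2)) (at x within {0..L})"
      by (simp add: has_real_derivative_iff_has_vector_derivative)
  qed
  then show "(\<lambda>x. t / (t\<^sup>2 + (x - x0)\<^sup>2)) integrable_on {0..L}" by blast
  show "integral {0..L} (\<lambda>x. t / (t\<^sup>2 + (x - x0)\<^sup>2)) \<le> pi"
    using integral_unique[OF int] arctan_bounded[of "(L - x0) / t"] arctan_bounded[of "(0 - x0) / t"] by linarith
qed

lemma vector_derivative_limit:
  assumes "(f has_vector_derivative v) (at x)"
  shows "((\<lambda>y. (f y - f x) /\<^sub>R (y - x)) \<longlongrightarrow> v) (at x)"
proof -
  have "((\<lambda>y. norm (f y - f x - (y - x) *\<^sub>R v) / norm (y - x)) \<longlongrightarrow> 0) (at x)"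
    using assms by (simp add: has_vector_derivative_def has_derivative_iff_norm)
  moreover have "\<forall>\<^sub>F y in at x. norm (f y - f x - (y - x) *\<^sub>R v) / norm (y - x) = norm ((f y - f x) /\<^sub>R (y - x) - v)"
    unfolding eventually_at_filter
  proof (rule always_eventually, intro allI impI)
    fix y :: real assume "y \<noteq> x"
    then have "(f y - f x) /\<^sub>R (y - x) - v = (f y - f x - (y - x) *\<^sub>R v) /\<^sub>R (y - x)"
      by (simp add: scaleR_diff_right)
    then show "norm (f y - f x - (y - x) *\<^sub>R v) / norm (y - x) = norm ((f y - f x) /\<^sub>R (y - x) - v)"
      by (simp add: divide_inverse mult.commute)
  qed
  ultimately have "((\<lambda>y. norm ((f y - f x) /\<^sub>R (y - x) - v)) \<longlongrightarrow> 0) (at x)"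
    by (simp add: tendsto_cong)
  then show ?thesis by (simp add: tendsto_norm_zero_iff LIM_zero_iff)
qed

lemma inner_sum_squares:
  fixes w v :: complex
  assumes "norm v = 1"
  shows "(w \<bullet> v)\<^sup>2 + (w \<bullet> (\<i> * v))\<^sup>2 = (norm w)\<^sup>2"
proof -
  have "(Re v)\<^sup>2 + (Im v)\<^sup>2 = 1" using assms by (simp add: cmod_def)
  moreover have "(w \<bullet> v)\<^sup>2 + (w \<bullet> (\<i> * v))\<^sup>2 = ((Re w)\<^sup>2 + (Im w)\<^sup>2) * ((Re v)\<^sup>2 + (Im v)\<^sup>2)"
    by (simp add: inner_complex_def power2_eq_square algebra_simps)
  ultimately show ?thesis by (simp add: cmod_power2)
qed

lemma symmetric_angle_inner:
  assumes "z \<in> symmetric_angle \<zeta> \<nu> \<theta>" "norm \<nu> = 1" "0 < \<theta>" "\<theta> < pi"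
  shows "cos (\<theta> / 2) * norm (z - \<zeta>) \<le> (z - \<zeta>) \<bullet> \<nu>"
proof -
  define w where "w = z - \<zeta>"
  have arg: "\<bar>Arg (w / \<nu>)\<bar> < \<theta> / 2" using assms(1) by (simp add: symmetric_angle_def w_def)
  have "cos (\<theta> / 2) \<le> cos \<bar>Arg (w / \<nu>)\<bar>"
    using arg assms by (intro cos_monotone_0_pi_le) auto
  then have "cos (\<theta> / 2) * norm w \<le> norm w * cos (Arg (w / \<nu>))"
    by (simp add: mult.commute mult_left_mono)
  also have "\<dots> = Re (rcis (norm (w / \<nu>)) (Arg (w / \<nu>)))" using assms(2) by (simp add: norm_divide)
  also have "\<dots> = Re (w / \<nu>)" by (simp only: rcis_cmod_Arg)
  also have "\<dots> = w \<bullet> \<nu>"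
  proof -
    have "(Re \<nu>)\<^sup>2 + (Im \<nu>)\<^sup>2 = 1" using assms(2) by (simp add: cmod_def)
    then show ?thesis by (simp add: Re_divide inner_complex_def)
  qed
  finally show ?thesis by (simp add: w_def)
qed

section \<open>Inner normals and non-tangential limits\<close>

context rectifiable_Jordan
begin

lemma orientation:
  obtains n :: real where "n = 1 \<or> n = -1"
    "\<And>z. z \<in> inside (path_image g) \<Longrightarrow> winding_number g z = of_real n"
  using simple_closed_path_winding_number_inside[OF simple] by (metis of_real_1 of_real_minus)

lemma winding_number_outside:
  "z \<in> outside (path_image g) \<Longrightarrow> winding_number g z = 0"
  by (rule winding_number_zero_in_outside) (use path closed_path in \<open>auto simp: pathfinish_def pathstart_def\<close>)

lemma h_inj_interior:
  "s\<^sub>0 \<in> {0<..<L} \<Longrightarrow> s \<in> {0..L} \<Longrightarrow> s \<noteq> s\<^sub>0 \<Longrightarrow> h s \<noteq> h s\<^sub>0"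
  using h_inj[of s s\<^sub>0] by auto

lemma has_unit_tangent_h:
  assumes s0: "s\<^sub>0 \<in> {0<..<L}" and der: "(h has_vector_derivative v) (at s\<^sub>0)" and v: "norm v = 1"
  shows "has_unit_tangent g (h s\<^sub>0) v"
proof -
  define t where "t = T s\<^sub>0"
  have S_t: "S t = s\<^sub>0" using s0 by (simp add: t_def S_T)
  have "t \<in> {0..1}" unfolding t_def by (rule T_in)
  moreover have "t \<noteq> 0" "t \<noteq> 1" using S_t s0 by (auto simp: S_0 L_def)
  ultimately have t: "0 < t" "t < 1" by auto
  have "continuous_on {0<..<1} S" by (rule continuous_on_subset[OF continuous_S]) auto
  then have "isCont S t" using t by (simp add: continuous_on_eq_continuous_at)
  then have S_lim: "(S \<longlongrightarrow> s\<^sub>0) (at t)" using S_t by (simp add: isCont_def)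
  have sgn_v: "sgn v = v" using v by (simp add: sgn_div_norm)
  have lim: "((\<lambda>y. sgn ((h y - h s\<^sub>0) /\<^sub>R (y - s\<^sub>0))) \<longlongrightarrow> v) (at s\<^sub>0)"
  proof -
    have "v \<noteq> 0" using v by auto
    from tendsto_sgn[OF vector_derivative_limit[OF der] this] show ?thesis by (simp only: sgn_v)
  qed
  have right: "filterlim S (at_right s\<^sub>0) (at_right t)"
    unfolding filterlim_at
  proof
    show "(S \<longlongrightarrow> s\<^sub>0) (at_right t)" using S_lim by (rule tendsto_within_subset) auto
    show "\<forall>\<^sub>F x in at_right t. S x \<in> {s\<^sub>0<..} \<and> S x \<noteq> s\<^sub>0"
      unfolding eventually_at_right_field using t S_t S_strict_mono[of t] by (intro exI[of _ 1]) (force simp: less_le)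
  qed
  have left: "filterlim S (at_left s\<^sub>0) (at_left t)"
    unfolding filterlim_at
  proof
    show "(S \<longlongrightarrow> s\<^sub>0) (at_left t)" using S_lim by (rule tendsto_within_subset) auto
    show "\<forall>\<^sub>F x in at_left t. S x \<in> {..<s\<^sub>0} \<and> S x \<noteq> s\<^sub>0"
      unfolding eventually_at_left_field using t S_t S_strict_mono[of _ t] by (intro exI[of _ 0]) (force simp: less_le)
  qed
  have lim_right: "((\<lambda>x. sgn (h (S x) - h s\<^sub>0)) \<longlongrightarrow> v) (at_right t)"
  proof (rule filterlim_compose[OF _ right])
    have "((\<lambda>y. sgn ((h y - h s\<^sub>0) /\<^sub>R (y - s\<^sub>0))) \<longlongrightarrow> v) (at_right s\<^sub>0)"
      using lim by (rule tendsto_within_subset) auto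
    moreover have "\<forall>\<^sub>F y in at_right s\<^sub>0. sgn ((h y - h s\<^sub>0) /\<^sub>R (y - s\<^sub>0)) = sgn (h y - h s\<^sub>0)"
      unfolding eventually_at_right_field by (intro exI[of _ "s\<^sub>0 + 1"]) (auto simp: sgn_scaleR)
    ultimately show "((\<lambda>y. sgn (h y - h s\<^sub>0)) \<longlongrightarrow> v) (at_right s\<^sub>0)" by (simp add: tendsto_cong)
  qed
  have lim_left: "((\<lambda>x. sgn (h (S x) - h s\<^sub>0)) \<longlongrightarrow> - v) (at_left t)"
  proof (rule filterlim_compose[OF _ left])
    have "((\<lambda>y. - sgn ((h y - h s\<^sub>0) /\<^sub>R (y - s\<^sub>0))) \<longlongrightarrow> - v) (at_left s\<^sub>0)"
      using lim by (intro tendsto_minus) (rule tendsto_within_subset, auto)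
    moreover have "\<forall>\<^sub>F y in at_left s\<^sub>0. - sgn ((h y - h s\<^sub>0) /\<^sub>R (y - s\<^sub>0)) = sgn (h y - h s\<^sub>0)"
      unfolding eventually_at_left_field by (intro exI[of _ "s\<^sub>0 - 1"]) (auto simp: sgn_scaleR)
    ultimately show "((\<lambda>y. sgn (h y - h s\<^sub>0)) \<longlongrightarrow> - v) (at_left s\<^sub>0)" by (simp add: tendsto_cong)
  qed
  have frac: "frac x = x" if "0 < x" "x < 1" for x :: real using that by (simp add: frac_eq)
  show ?thesis
    unfolding has_unit_tangent_def
  proof (intro exI[of _ t] conjI)
    show "g (frac t) = h s\<^sub>0" using t frac[of t] by (simp add: h_def t_def)
    have "\<forall>\<^sub>F x in at_right t. sgn (h (S x) - h s\<^sub>0) = sgn (g (frac x) - h s\<^sub>0)"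
      unfolding eventually_at_right_field using t by (intro exI[of _ 1]) (auto simp: frac h_S)
    then show "((\<lambda>x. sgn (g (frac x) - h s\<^sub>0)) \<longlongrightarrow> v) (at_right t)"
      using lim_right by (simp add: tendsto_cong)
    have "\<forall>\<^sub>F x in at_left t. sgn (h (S x) - h s\<^sub>0) = sgn (g (frac x) - h s\<^sub>0)"
      unfolding eventually_at_left_field using t by (intro exI[of _ 0]) (auto simp: frac h_S)
    then show "((\<lambda>x. sgn (g (frac x) - h s\<^sub>0)) \<longlongrightarrow> - v) (at_left t)"
      using lim_left by (simp add: tendsto_cong)
  qed
qed

text \<open>The winding numbers about the two points differ by \<open>1\<close> for small \<open>\<rho>\<close>, and each is \<open>n\<close> or \<open>0\<close>. So the
  point of the left normal has winding number \<open>1\<close> if \<open>n = 1\<close>, and the one of the right normal has \<open>-1\<close> if \<open>n = -1\<close>.\<close>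

lemma sides_of_tangent:
  assumes s0: "s\<^sub>0 \<in> {0<..<L}" and der: "(h has_vector_derivative v) (at s\<^sub>0)" and v: "norm v = 1"
    and n: "n = 1 \<or> n = -1" "\<And>z. z \<in> inside (path_image g) \<Longrightarrow> winding_number g z = of_real n"
  shows "\<forall>\<^sub>F \<rho> in at_right 0. h s\<^sub>0 + of_real \<rho> * (of_real n * \<i> * v) \<in> inside (path_image g) \<and>
     h s\<^sub>0 - of_real \<rho> * (of_real n * \<i> * v) \<in> outside (path_image g)"
proof -
  note inj = h_inj_interior[OF s0]
  have s0': "s\<^sub>0 \<in> {0..L}" using s0 by auto
  obtain c r where cr: "0 < c" "0 < r"
    "\<And>s w. s \<in> {0..L} \<Longrightarrow> norm w < r \<Longrightarrow> \<bar>w \<bullet> v\<bar> \<le> 0 * norm w \<Longrightarrow>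
       c * sqrt ((norm w)\<^sup>2 + (s - s\<^sub>0)\<^sup>2) \<le> norm (h s - (h s\<^sub>0 + w))"
    by (rule cone_estimate[OF s0' der v inj, of 0]) auto
  have off: "h s\<^sub>0 + of_real \<rho> * (\<i> * v) \<notin> path_image g" if "\<bar>\<rho>\<bar> < r" "\<rho> \<noteq> 0" for \<rho>
  proof
    assume "h s\<^sub>0 + of_real \<rho> * (\<i> * v) \<in> path_image g"
    then obtain s where s: "s \<in> {0..L}" "h s = h s\<^sub>0 + of_real \<rho> * (\<i> * v)" unfolding path_image_h by force
    have "(of_real \<rho> * (\<i> * v)) \<bullet> v = 0" by (simp add: inner_complex_def)
    then have "c * sqrt (\<rho>\<^sup>2 + (s - s\<^sub>0)\<^sup>2) \<le> 0"
      using cr(3)[OF s(1), of "of_real \<rho> * (\<i> * v)"] s(2) that(1) v by (simp add: norm_mult)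
    moreover have "0 < c * sqrt (\<rho>\<^sup>2 + (s - s\<^sub>0)\<^sup>2)" using cr(1) that(2) by (simp add: add_pos_nonneg)
    ultimately show False by linarith
  qed
  have "\<forall>\<^sub>F \<rho> in at_right 0. \<rho> < r \<and> 0 < \<rho>"
    using cr(2) by (auto simp: eventually_at_right_field)
  moreover have "\<forall>\<^sub>F \<rho> in at_right 0. dist (integral {0..L} (\<lambda>s. 1 / (h s - (h s\<^sub>0 + of_real \<rho> * (\<i> * v))) * u s)
              - integral {0..L} (\<lambda>s. 1 / (h s - (h s\<^sub>0 - of_real \<rho> * (\<i> * v))) * u s)) (2 * of_real pi * \<i>) < 2 * pi"
    by (rule tendstoD[OF kernel_jump[OF s0 der v inj]]) auto
  ultimately show ?thesis
  proof eventually_elim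
    case (elim \<rho>)
    define z where "z = h s\<^sub>0 + of_real \<rho> * (\<i> * v)"
    define z' where "z' = h s\<^sub>0 - of_real \<rho> * (\<i> * v)"
    have off': "z \<notin> path_image g" "z' \<notin> path_image g"
      using off[of \<rho>] off[of "-\<rho>"] elim(1) by (auto simp: z_def z'_def)
    have "dist (2 * of_real pi * \<i> * winding_number g z - 2 * of_real pi * \<i> * winding_number g z') (2 * of_real pi * \<i>) < 2 * pi"
      using elim(2) winding_number_integral[OF off'(1)] winding_number_integral[OF off'(2)] by (simp add: z_def z'_def)
    moreover have "2 * of_real pi * \<i> * winding_number g z - 2 * of_real pi * \<i> * winding_number g z' - 2 * of_real pi * \<i>
        = 2 * of_real pi * \<i> * (winding_number g z - winding_number g z' - 1)" by (simp add: algebra_simps)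
    ultimately have lt: "norm (winding_number g z - winding_number g z' - 1) < 1"
      by (simp add: dist_norm norm_mult)
    have zin: "z \<in> inside (path_image g) \<or> z \<in> outside (path_image g)"
      and z'in: "z' \<in> inside (path_image g) \<or> z' \<in> outside (path_image g)"
      using off' inside_Un_outside[of "path_image g"] by blast+
    from n(1) show ?case
    proof
      assume "n = 1"
      then have "z \<in> inside (path_image g) \<and> z' \<in> outside (path_image g)"
        using zin z'in lt n(2) winding_number_outside by (auto simp: norm_minus_commute)
      then show ?thesis using \<open>n = 1\<close> by (simp add: z_def z'_def)
    next
      assume "n = -1"
      then have "z \<in> outside (path_image g) \<and> z' \<in> inside (path_image g)"
        using zin z'in lt n(2) winding_number_outside by (auto simp: norm_minus_commute)
      then show ?thesis using \<open>n = -1\<close> by (simp add: z_def z'_def)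
    qed
  qed
qed

text \<open>A truncated cone about the normal is convex and, by \<open>cone_estimate\<close>, does not meet the curve; the same holds for
  its reflection. Each therefore lies in the component that contains its points on the normal line.\<close>

lemma cone_sides:
  assumes s0: "s\<^sub>0 \<in> {0<..<L}" and der: "(h has_vector_derivative v) (at s\<^sub>0)" and v: "norm v = 1"
    and n: "n = 1 \<or> n = -1" "\<And>z. z \<in> inside (path_image g) \<Longrightarrow> winding_number g z = of_real n"
    and \<kappa>: "0 < \<kappa>" "\<kappa> \<le> 1"
  obtains c r where "0 < c" "0 < r"
    "\<And>w. w \<noteq> 0 \<Longrightarrow> norm w < r \<Longrightarrow> \<kappa> * norm w \<le> w \<bullet> (of_real n * \<i> * v) \<Longrightarrow>
      h s\<^sub>0 + w \<in> inside (path_image g) \<and> h s\<^sub>0 - w \<in> outside (path_image g) \<and>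
      (\<forall>s\<in>{0..L}. c * sqrt ((norm w)\<^sup>2 + (s - s\<^sub>0)\<^sup>2) \<le> norm (h s - (h s\<^sub>0 + w)) \<and>
                  c * sqrt ((norm w)\<^sup>2 + (s - s\<^sub>0)\<^sup>2) \<le> norm (h s - (h s\<^sub>0 - w)))"
proof -
  note inj = h_inj_interior[OF s0]
  have s0': "s\<^sub>0 \<in> {0..L}" using s0 by auto
  define \<nu> where "\<nu> = of_real n * \<i> * v"
  have \<nu>: "norm \<nu> = 1" using n(1) v by (auto simp: \<nu>_def norm_mult)
  define \<sigma> where "\<sigma> = sqrt (1 - \<kappa>\<^sup>2)"
  have \<kappa>2: "0 < \<kappa>\<^sup>2" "\<kappa>\<^sup>2 \<le> 1" using \<kappa> by (auto simp: power_le_one)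
  have \<sigma>: "0 \<le> \<sigma>" "\<sigma> < 1" using \<kappa>2 by (auto simp: \<sigma>_def)
  have sq: "(w \<bullet> v)\<^sup>2 + (w \<bullet> \<nu>)\<^sup>2 = (norm w)\<^sup>2" for w
    using inner_sum_squares[OF v, of w] n(1) by (auto simp: \<nu>_def)
  have tilt: "\<bar>w \<bullet> v\<bar> \<le> \<sigma> * norm w" if "\<kappa> * norm w \<le> w \<bullet> \<nu>" for w
  proof -
    have "(\<kappa> * norm w)\<^sup>2 \<le> (w \<bullet> \<nu>)\<^sup>2" using that \<kappa> by (intro power_mono) auto
    then have "(w \<bullet> v)\<^sup>2 \<le> (\<sigma> * norm w)\<^sup>2"
      using sq[of w] \<kappa>2 by (simp add: \<sigma>_def power_mult_distrib algebra_simps)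
    then show ?thesis using \<sigma>(1) abs_le_square_iff[of "w \<bullet> v" "\<sigma> * norm w"] by (simp add: abs_mult)
  qed
  obtain c r where cr: "0 < c" "0 < r"
    "\<And>s w. s \<in> {0..L} \<Longrightarrow> norm w < r \<Longrightarrow> \<bar>w \<bullet> v\<bar> \<le> \<sigma> * norm w \<Longrightarrow>
       c * sqrt ((norm w)\<^sup>2 + (s - s\<^sub>0)\<^sup>2) \<le> norm (h s - (h s\<^sub>0 + w))"
    by (rule cone_estimate[OF s0' der v inj \<sigma>]) auto
  \<comment> \<open>The condition \<open>0 < w \<bullet> \<nu>\<close> removes the vertex and keeps the cone convex.\<close>
  define C where "C = {w. norm w < r \<and> 0 < w \<bullet> \<nu> \<and> \<kappa> * norm w \<le> w \<bullet> \<nu>}"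
  have est: "c * sqrt ((norm w)\<^sup>2 + (s - s\<^sub>0)\<^sup>2) \<le> norm (h s - (h s\<^sub>0 + w))"
       "c * sqrt ((norm w)\<^sup>2 + (s - s\<^sub>0)\<^sup>2) \<le> norm (h s - (h s\<^sub>0 - w))" if "w \<in> C" "s \<in> {0..L}" for w s
    using cr(3)[OF that(2), of w] cr(3)[OF that(2), of "-w"] tilt[of w] that(1) by (auto simp: C_def)
  have "convex C"
  proof (rule convexI)
    fix x y :: complex and a b :: real assume xy: "x \<in> C" "y \<in> C" and ab: "0 \<le> a" "0 \<le> b" "a + b = 1"
    have tri: "norm (a *\<^sub>R x + b *\<^sub>R y) \<le> a * norm x + b * norm y"
      using norm_triangle_ineq[of "a *\<^sub>R x" "b *\<^sub>R y"] ab by simp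
    have "a * norm x + b * norm y < r"
      using xy ab by (intro convex_bound_lt) (auto simp: C_def)
    moreover have "0 < a * (x \<bullet> \<nu>) + b * (y \<bullet> \<nu>)"
      using xy ab by (cases "a = 0") (auto simp: C_def intro!: add_pos_nonneg)
    moreover have "\<kappa> * (a * norm x + b * norm y) \<le> a * (x \<bullet> \<nu>) + b * (y \<bullet> \<nu>)"
    proof -
      have "a * (\<kappa> * norm x) + b * (\<kappa> * norm y) \<le> a * (x \<bullet> \<nu>) + b * (y \<bullet> \<nu>)"
        using xy ab by (intro add_mono mult_left_mono) (auto simp: C_def)
      then show ?thesis by (simp add: algebra_simps)
    qed
    moreover have "\<kappa> * norm (a *\<^sub>R x + b *\<^sub>R y) \<le> \<kappa> * (a * norm x + b * norm y)"
      using tri \<kappa>(1) by (intro mult_left_mono) auto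
    ultimately have "norm (a *\<^sub>R x + b *\<^sub>R y) < r" "0 < a * (x \<bullet> \<nu>) + b * (y \<bullet> \<nu>)"
        "\<kappa> * norm (a *\<^sub>R x + b *\<^sub>R y) \<le> a * (x \<bullet> \<nu>) + b * (y \<bullet> \<nu>)"
      using tri by linarith+
    then show "a *\<^sub>R x + b *\<^sub>R y \<in> C" by (simp add: C_def inner_add_left)
  qed
  have in_C: "of_real \<rho> * \<nu> \<in> C" if "0 < \<rho>" "\<rho> < r" for \<rho>
  proof -
    have "(of_real \<rho> * \<nu>) \<bullet> \<nu> = \<rho>"
      using \<nu> by (simp add: scaleR_conv_of_real[symmetric] power2_norm_eq_inner[symmetric])
    then show ?thesis using that \<kappa> \<nu> by (simp add: C_def norm_mult mult_left_le_one_le)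
  qed
  have "\<forall>\<^sub>F \<rho> in at_right 0. (h s\<^sub>0 + of_real \<rho> * \<nu> \<in> inside (path_image g) \<and>
     h s\<^sub>0 - of_real \<rho> * \<nu> \<in> outside (path_image g)) \<and> 0 < \<rho> \<and> \<rho> < r"
    unfolding \<nu>_def using cr(2)
    by (intro eventually_conj[OF sides_of_tangent[OF s0 der v n]]) (auto simp: eventually_at_right_field)
  then obtain \<rho> where \<rho>: "h s\<^sub>0 + of_real \<rho> * \<nu> \<in> inside (path_image g)"
      "h s\<^sub>0 - of_real \<rho> * \<nu> \<in> outside (path_image g)" "0 < \<rho>" "\<rho> < r"
    using eventually_happens'[OF trivial_limit_at_right_real] by blast
  have offp: "h s\<^sub>0 + w \<notin> path_image g" "h s\<^sub>0 - w \<notin> path_image g" if "w \<in> C" for w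
  proof -
    have "w \<noteq> 0" using that by (auto simp: C_def)
    then have "0 < c * sqrt ((norm w)\<^sup>2 + (s - s\<^sub>0)\<^sup>2)" for s using cr(1) by (simp add: add_pos_nonneg)
    then have "h s \<noteq> h s\<^sub>0 + w" "h s \<noteq> h s\<^sub>0 - w" if "s \<in> {0..L}" for s
      using est[OF \<open>w \<in> C\<close> that] by (metis diff_self norm_zero not_less)+
    then show "h s\<^sub>0 + w \<notin> path_image g" "h s\<^sub>0 - w \<notin> path_image g"
      unfolding path_image_h image_iff by (metis, metis)
  qed
  show ?thesis
  proof (rule that[OF cr(1,2)])
    fix w assume w: "w \<noteq> 0" "norm w < r" "\<kappa> * norm w \<le> w \<bullet> (of_real n * \<i> * v)"
    then have "0 < \<kappa> * norm w" using \<kappa> by simp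
    then have wC: "w \<in> C" using w by (auto simp: C_def \<nu>_def)
    have "connected_component (- path_image g) (h s\<^sub>0 + of_real \<rho> * \<nu>) (h s\<^sub>0 + w)"
      unfolding connected_component_def
    proof (intro exI[of _ "(\<lambda>w. h s\<^sub>0 + w) ` C"] conjI)
      show "connected ((\<lambda>w. h s\<^sub>0 + w) ` C)"
        by (intro connected_continuous_image convex_connected \<open>convex C\<close> continuous_intros)
    qed (use offp wC in_C[OF \<rho>(3,4)] in auto)
    then have 1: "h s\<^sub>0 + w \<in> inside (path_image g)" by (rule inside_same_component[OF _ \<rho>(1)])
    have "connected_component (- path_image g) (h s\<^sub>0 - of_real \<rho> * \<nu>) (h s\<^sub>0 - w)"
      unfolding connected_component_def
    proof (intro exI[of _ "(\<lambda>w. h s\<^sub>0 - w) ` C"] conjI)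
      show "connected ((\<lambda>w. h s\<^sub>0 - w) ` C)"
        by (intro connected_continuous_image convex_connected \<open>convex C\<close> continuous_intros)
    qed (use offp wC in_C[OF \<rho>(3,4)] in auto)
    then have 2: "h s\<^sub>0 - w \<in> outside (path_image g)" by (rule outside_same_component[OF _ \<rho>(2)])
    show "h s\<^sub>0 + w \<in> inside (path_image g) \<and> h s\<^sub>0 - w \<in> outside (path_image g) \<and>
      (\<forall>s\<in>{0..L}. c * sqrt ((norm w)\<^sup>2 + (s - s\<^sub>0)\<^sup>2) \<le> norm (h s - (h s\<^sub>0 + w)) \<and>
                  c * sqrt ((norm w)\<^sup>2 + (s - s\<^sub>0)\<^sup>2) \<le> norm (h s - (h s\<^sub>0 - w)))"
      using 1 2 est[OF wC] by blast
  qed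
qed

text \<open>The main estimate. Continuity of \<open>F\<close> is used in the form \<open>\<bar>F s - F s\<^sub>0\<bar> \<le> \<epsilon> + K (s - s\<^sub>0)\<^sup>2\<close>: against the Poisson kernel,
  the first term contributes at most \<open>\<pi> \<epsilon>\<close> and the second at most \<open>K L \<bar>w\<bar>\<close>.\<close>

lemma cauchy_integral_cone_limit:
  assumes s0: "s\<^sub>0 \<in> {0<..<L}" and der: "(h has_vector_derivative v) (at s\<^sub>0)" and v: "norm v = 1"
    and n: "n = 1 \<or> n = -1" "\<And>z. z \<in> inside (path_image g) \<Longrightarrow> winding_number g z = of_real n"
    and \<kappa>: "0 < \<kappa>" "\<kappa> \<le> 1" and F: "continuous_on {0..L} F"
    and outer: "\<And>z. z \<in> outside (path_image g) \<Longrightarrow> cauchy_integral F z = 0"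
  shows "((\<lambda>z. of_real n / (2 * of_real pi * \<i>) * cauchy_integral F z) \<longlongrightarrow> F s\<^sub>0)
     (at (h s\<^sub>0) within {z. \<kappa> * norm (z - h s\<^sub>0) \<le> (z - h s\<^sub>0) \<bullet> (of_real n * \<i> * v)})"
  unfolding tendsto_iff
proof (intro allI impI)
  fix e :: real assume "0 < e"
  define \<phi> where "\<phi> z = of_real n / (2 * of_real pi * \<i>) * cauchy_integral F z" for z
  obtain c r where cr: "0 < c" "0 < r"
    "\<And>w. w \<noteq> 0 \<Longrightarrow> norm w < r \<Longrightarrow> \<kappa> * norm w \<le> w \<bullet> (of_real n * \<i> * v) \<Longrightarrow>
      h s\<^sub>0 + w \<in> inside (path_image g) \<and> h s\<^sub>0 - w \<in> outside (path_image g) \<and>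
      (\<forall>s\<in>{0..L}. c * sqrt ((norm w)\<^sup>2 + (s - s\<^sub>0)\<^sup>2) \<le> norm (h s - (h s\<^sub>0 + w)) \<and>
                  c * sqrt ((norm w)\<^sup>2 + (s - s\<^sub>0)\<^sup>2) \<le> norm (h s - (h s\<^sub>0 - w)))"
    by (rule cone_sides[OF s0 der v n \<kappa>], assumption, rule that)
  have s0': "s\<^sub>0 \<in> {0..L}" using s0 by auto
  \<comment> \<open>The factor is chosen so that the Poisson integral contributes \<open>e / 2\<close>.\<close>
  define \<epsilon> where "\<epsilon> = e * c\<^sup>2 / 2"
  have "0 < \<epsilon>" using \<open>0 < e\<close> cr(1) by (simp add: \<epsilon>_def)
  obtain K where K: "0 \<le> K" "\<And>s. s \<in> {0..L} \<Longrightarrow> norm (F s - F s\<^sub>0) \<le> \<epsilon> + K * (s - s\<^sub>0)\<^sup>2"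
  proof -
    obtain \<eta> where \<eta>: "0 < \<eta>" "\<And>s. s \<in> {0..L} \<Longrightarrow> \<bar>s - s\<^sub>0\<bar> < \<eta> \<Longrightarrow> norm (F s - F s\<^sub>0) < \<epsilon>"
      using F s0' \<open>0 < \<epsilon>\<close> unfolding continuous_on_iff dist_norm by (metis real_norm_def)
    have "compact (F ` {0..L})" using F by (intro compact_continuous_image) auto
    then obtain M where M: "0 < M" "\<And>s. s \<in> {0..L} \<Longrightarrow> norm (F s) \<le> M"
      using compact_imp_bounded by (metis bounded_pos image_eqI)
    show ?thesis
    proof (rule that[of "2 * M / \<eta>\<^sup>2"])
      show "0 \<le> 2 * M / \<eta>\<^sup>2" using M by simp
      fix s assume s: "s \<in> {0..L}"
      show "norm (F s - F s\<^sub>0) \<le> \<epsilon> + 2 * M / \<eta>\<^sup>2 * (s - s\<^sub>0)\<^sup>2"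
      proof (cases "\<bar>s - s\<^sub>0\<bar> < \<eta>")
        case True
        then have "norm (F s - F s\<^sub>0) \<le> \<epsilon>" using \<eta>(2)[OF s] by simp
        moreover have "0 \<le> 2 * M / \<eta>\<^sup>2 * (s - s\<^sub>0)\<^sup>2" using M by simp
        ultimately show ?thesis by linarith
      next
        case False
        then have "\<eta>\<^sup>2 \<le> (s - s\<^sub>0)\<^sup>2" using \<eta>(1) by (intro abs_le_square_iff[THEN iffD1]) auto
        then have "2 * M / \<eta>\<^sup>2 * \<eta>\<^sup>2 \<le> 2 * M / \<eta>\<^sup>2 * (s - s\<^sub>0)\<^sup>2" using M by (intro mult_left_mono) auto
        then have "2 * M \<le> 2 * M / \<eta>\<^sup>2 * (s - s\<^sub>0)\<^sup>2" using \<eta>(1) by simp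
        moreover have "norm (F s - F s\<^sub>0) \<le> 2 * M"
          using norm_triangle_ineq4[of "F s" "F s\<^sub>0"] M(2)[OF s] M(2)[OF s0'] by linarith
        ultimately show ?thesis using \<open>0 < \<epsilon>\<close> by linarith
      qed
    qed
  qed
  have est: "norm (\<phi> (h s\<^sub>0 + w) - F s\<^sub>0) \<le> e / 2 + K * L / (pi * c\<^sup>2) * norm w"
    if w: "w \<noteq> 0" "norm w < r" "\<kappa> * norm w \<le> w \<bullet> (of_real n * \<i> * v)" for w
  proof -
    define z where "z = h s\<^sub>0 + w"
    define z' where "z' = h s\<^sub>0 - w"
    define t where "t = norm w"
    have t: "0 < t" using w by (simp add: t_def)
    have z: "z \<in> inside (path_image g)" and z': "z' \<in> outside (path_image g)"
      and low: "\<And>s. s \<in> {0..L} \<Longrightarrow> c * sqrt (t\<^sup>2 + (s - s\<^sub>0)\<^sup>2) \<le> norm (h s - z)"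
               "\<And>s. s \<in> {0..L} \<Longrightarrow> c * sqrt (t\<^sup>2 + (s - s\<^sub>0)\<^sup>2) \<le> norm (h s - z')"
      using cr(3)[OF w] by (auto simp: z_def z'_def t_def)
    have oz: "z \<notin> path_image g" "z' \<notin> path_image g"
      using z z' inside_no_overlap[of "path_image g"] outside_no_overlap[of "path_image g"] by blast+
    have oz': "z \<notin> h ` {0..L}" "z' \<notin> h ` {0..L}" using oz by (auto simp: path_image_h)
    define k where "k s = 1 / (h s - z) - 1 / (h s - z')" for s
    have cont_k: "continuous_on {0..L} k" unfolding k_def
      by (intro continuous_on_diff kernel_continuous oz')
    have "integral {0..L} (\<lambda>s. k s * u s)
       = integral {0..L} (\<lambda>s. 1 / (h s - z) * u s) - integral {0..L} (\<lambda>s. 1 / (h s - z') * u s)"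
      unfolding k_def left_diff_distrib by (intro integral_diff weighted_integrable kernel_continuous oz') auto
    also have "\<dots> = 2 * of_real pi * \<i> * of_real n"
      using winding_number_integral[OF oz(1)] winding_number_integral[OF oz(2)] n(2)[OF z] winding_number_outside[OF z'] by simp
    finally have k1: "integral {0..L} (\<lambda>s. k s * u s) = 2 * of_real pi * \<i> * of_real n" .
    have "cauchy_integral F z = cauchy_integral F z - cauchy_integral F z'" using outer[OF z'] by simp
    also have "\<dots> = integral {0..L} (\<lambda>s. F s / (h s - z) * u s - F s / (h s - z') * u s)"
      unfolding cauchy_integral_def
      by (intro integral_diff[symmetric] weighted_integrable cauchy_kernel_continuous F oz') auto
    also have "\<dots> = integral {0..L} (\<lambda>s. (F s * k s) * u s)" by (simp add: k_def algebra_simps)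
    finally have k2: "cauchy_integral F z = integral {0..L} (\<lambda>s. (F s * k s) * u s)" .
    have "integral {0..L} (\<lambda>s. ((F s - F s\<^sub>0) * k s) * u s)
       = integral {0..L} (\<lambda>s. (F s * k s) * u s - F s\<^sub>0 * (k s * u s))" by (simp add: algebra_simps)
    also have "\<dots> = integral {0..L} (\<lambda>s. (F s * k s) * u s) - integral {0..L} (\<lambda>s. F s\<^sub>0 * (k s * u s))"
      by (intro integral_diff integrable_on_mult_right weighted_integrable continuous_on_mult F cont_k) auto
    finally have k3: "integral {0..L} (\<lambda>s. ((F s - F s\<^sub>0) * k s) * u s) = cauchy_integral F z - F s\<^sub>0 * (2 * of_real pi * \<i> * of_real n)"
      using k1 k2 by simp
    have nn: "of_real n * of_real n = (1::complex)" using n(1) by auto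
    have "\<phi> z - F s\<^sub>0 = of_real n / (2 * of_real pi * \<i>) * integral {0..L} (\<lambda>s. ((F s - F s\<^sub>0) * k s) * u s)"
      unfolding k3 \<phi>_def using nn by (simp add: field_simps)
    then have dev: "norm (\<phi> z - F s\<^sub>0) = norm (integral {0..L} (\<lambda>s. ((F s - F s\<^sub>0) * k s) * u s)) / (2 * pi)"
      using n(1) by (auto simp: norm_mult norm_divide)
    have "norm (integral {0..L} (\<lambda>s. ((F s - F s\<^sub>0) * k s) * u s))
      \<le> integral {0..L} (\<lambda>s. 2 * \<epsilon> / c\<^sup>2 * (t / (t\<^sup>2 + (s - s\<^sub>0)\<^sup>2)) + 2 * K * t / c\<^sup>2)"
    proof (rule weighted_integral_bound)
      show "continuous_on {0..L} (\<lambda>s. (F s - F s\<^sub>0) * k s)" by (intro continuous_intros F cont_k)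
      show "(\<lambda>s. 2 * \<epsilon> / c\<^sup>2 * (t / (t\<^sup>2 + (s - s\<^sub>0)\<^sup>2)) + 2 * K * t / c\<^sup>2) integrable_on {0..L}"
        using poisson_kernel_integral(1)[OF t, of L s\<^sub>0] L_pos
        by (intro integrable_add integrable_on_mult_right) auto
      fix s assume s: "s \<in> {0..L}"
      define Q where "Q = t\<^sup>2 + (s - s\<^sub>0)\<^sup>2"
      have Q: "0 < Q" "(s - s\<^sub>0)\<^sup>2 \<le> Q" using t by (auto simp: Q_def add_pos_nonneg)
      have nz: "h s - z \<noteq> 0" "h s - z' \<noteq> 0" using off_path[OF oz'(1) s] off_path[OF oz'(2) s] by auto
      have "k s = (z - z') / ((h s - z) * (h s - z'))" using nz by (simp add: k_def field_simps)
      then have "norm (k s) = 2 * t / (norm (h s - z) * norm (h s - z'))"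
        by (simp add: z_def z'_def norm_divide norm_mult t_def)
      also have "\<dots> \<le> 2 * t / (c\<^sup>2 * Q)"
      proof (rule divide_left_mono)
        have "c * sqrt Q * (c * sqrt Q) \<le> norm (h s - z) * norm (h s - z')"
          using low[OF s] cr(1) Q by (intro mult_mono) (auto simp: Q_def)
        moreover have "c * sqrt Q * (c * sqrt Q) = c\<^sup>2 * Q" using Q by (simp add: power2_eq_square)
        ultimately show "c\<^sup>2 * Q \<le> norm (h s - z) * norm (h s - z')" by simp
        show "0 < norm (h s - z) * norm (h s - z') * (c\<^sup>2 * Q)" using nz cr(1) Q by simp
      qed (use t in simp)
      finally have nk: "norm (k s) \<le> 2 * t / (c\<^sup>2 * Q)" .
      have "norm ((F s - F s\<^sub>0) * k s) \<le> (\<epsilon> + K * (s - s\<^sub>0)\<^sup>2) * (2 * t / (c\<^sup>2 * Q))"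
        unfolding norm_mult using K(1) \<open>0 < \<epsilon>\<close> by (intro mult_mono K(2)[OF s] nk) auto
      also have "\<dots> \<le> (\<epsilon> + K * Q) * (2 * t / (c\<^sup>2 * Q))"
        using Q K(1) t by (intro mult_right_mono) (auto simp: mult_left_mono)
      also have "\<dots> = 2 * \<epsilon> / c\<^sup>2 * (t / Q) + 2 * K * t / c\<^sup>2"
        using Q cr(1) by (simp add: field_simps)
      finally show "norm ((F s - F s\<^sub>0) * k s) \<le> 2 * \<epsilon> / c\<^sup>2 * (t / (t\<^sup>2 + (s - s\<^sub>0)\<^sup>2)) + 2 * K * t / c\<^sup>2"
        by (simp add: Q_def)
    qed auto
    also have "\<dots> = integral {0..L} (\<lambda>s. 2 * \<epsilon> / c\<^sup>2 * (t / (t\<^sup>2 + (s - s\<^sub>0)\<^sup>2)))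
        + integral {0..L} (\<lambda>s. 2 * K * t / c\<^sup>2)"
      using poisson_kernel_integral(1)[OF t, of L s\<^sub>0] L_pos
      by (intro integral_add integrable_on_mult_right integrable_const_ivl) simp
    also have "\<dots> = 2 * \<epsilon> / c\<^sup>2 * integral {0..L} (\<lambda>s. t / (t\<^sup>2 + (s - s\<^sub>0)\<^sup>2)) + 2 * K * t / c\<^sup>2 * L"
      using L_pos by (simp only: integral_mult_right) (simp add: ac_simps)
    also have "\<dots> \<le> 2 * \<epsilon> / c\<^sup>2 * pi + 2 * K * t / c\<^sup>2 * L"
      using poisson_kernel_integral(2)[OF t, of L s\<^sub>0] L_pos \<open>0 < \<epsilon>\<close> by (intro add_right_mono mult_left_mono) auto
    finally have "norm (\<phi> z - F s\<^sub>0) \<le> (2 * \<epsilon> / c\<^sup>2 * pi + 2 * K * t / c\<^sup>2 * L) / (2 * pi)"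
      unfolding dev by (rule divide_right_mono) simp
    also have "\<dots> = e / 2 + K * L / (pi * c\<^sup>2) * t"
      using cr(1) by (simp add: \<epsilon>_def field_simps)
    finally show ?thesis by (simp add: z_def t_def)
  qed
  define d where "d = min r (e / 2 / (K * L / (pi * c\<^sup>2) + 1))"
  have KL: "0 \<le> K * L / (pi * c\<^sup>2)" using K(1) L_pos by simp
  have d: "0 < d" using cr(2) \<open>0 < e\<close> KL by (simp add: d_def)
  show "\<forall>\<^sub>F z in at (h s\<^sub>0) within {z. \<kappa> * norm (z - h s\<^sub>0) \<le> (z - h s\<^sub>0) \<bullet> (of_real n * \<i> * v)}.
      dist (of_real n / (2 * of_real pi * \<i>) * cauchy_integral F z) (F s\<^sub>0) < e"
    unfolding eventually_at
  proof (intro exI[of _ d] conjI ballI impI d)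
    fix z assume z: "z \<in> {z. \<kappa> * norm (z - h s\<^sub>0) \<le> (z - h s\<^sub>0) \<bullet> (of_real n * \<i> * v)}"
      "z \<noteq> h s\<^sub>0 \<and> dist z (h s\<^sub>0) < d"
    define w where "w = z - h s\<^sub>0"
    have w: "w \<noteq> 0" "norm w < d" using z(2) by (auto simp: w_def dist_norm)
    have "norm (\<phi> (h s\<^sub>0 + w) - F s\<^sub>0) \<le> e / 2 + K * L / (pi * c\<^sup>2) * norm w"
      by (rule est) (use z w in \<open>auto simp: w_def d_def\<close>)
    moreover have "K * L / (pi * c\<^sup>2) * norm w < e / 2"
    proof -
      have "norm w < e / 2 / (K * L / (pi * c\<^sup>2) + 1)" using w(2) by (simp add: d_def)
      moreover have "0 < K * L / (pi * c\<^sup>2) + 1" using KL by linarith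
      ultimately have "norm w * (K * L / (pi * c\<^sup>2) + 1) < e / 2" by (subst (asm) pos_less_divide_eq)
      moreover have "0 < norm w" using w by simp
      ultimately show ?thesis unfolding distrib_left by (simp only: mult.commute mult_1_right)
    qed
    ultimately have "norm (\<phi> (h s\<^sub>0 + w) - F s\<^sub>0) < e" by linarith
    then show "dist (of_real n / (2 * of_real pi * \<i>) * cauchy_integral F z) (F s\<^sub>0) < e"
      by (simp add: dist_norm \<phi>_def w_def)
  qed
qed

lemma nontangential_limit:
  assumes s0: "s\<^sub>0 \<in> {0<..<L}" and der: "(h has_vector_derivative v) (at s\<^sub>0)" and v: "norm v = 1"
    and n: "n = 1 \<or> n = -1" "\<And>z. z \<in> inside (path_image g) \<Longrightarrow> winding_number g z = of_real n"
    and F: "continuous_on {0..L} F"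
    and outer: "\<And>z. z \<in> outside (path_image g) \<Longrightarrow> cauchy_integral F z = 0"
  shows "has_nontangential_limit g (\<lambda>z. of_real n / (2 * of_real pi * \<i>) * cauchy_integral F z) (h s\<^sub>0) (F s\<^sub>0)"
  unfolding has_nontangential_limit_def
proof (intro exI[of _ "of_real n * \<i> * v"] conjI allI impI)
  show "inner_unit_normal g (h s\<^sub>0) (of_real n * \<i> * v)"
    unfolding inner_unit_normal_def
  proof
    show "\<exists>w. has_unit_tangent g (h s\<^sub>0) w \<and> (of_real n * \<i> * v = \<i> * w \<or> of_real n * \<i> * v = - \<i> * w)"
      using has_unit_tangent_h[OF s0 der v] n(1) by (intro exI[of _ v]) auto
    show "\<forall>\<^sub>F r in at_right 0. h s\<^sub>0 + of_real r * (of_real n * \<i> * v) \<in> inside (path_image g)"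
    proof -
      have "\<forall>\<^sub>F r in at_right 0. h s\<^sub>0 + of_real r * (of_real n * \<i> * v) \<in> inside (path_image g) \<and>
          h s\<^sub>0 - of_real r * (of_real n * \<i> * v) \<in> outside (path_image g)"
        by (rule sides_of_tangent[OF s0 der v n])
      then show ?thesis by (rule eventually_mono) (erule conjunct1)
    qed
  qed
  fix \<theta> :: real assume \<theta>: "0 < \<theta> \<and> \<theta> < pi"
  have \<nu>: "norm (of_real n * \<i> * v) = 1" using n(1) v by (auto simp: norm_mult)
  have "0 < cos (\<theta> / 2)" using \<theta> by (intro cos_gt_zero) auto
  then have lim: "((\<lambda>z. of_real n / (2 * of_real pi * \<i>) * cauchy_integral F z) \<longlongrightarrow> F s\<^sub>0)
     (at (h s\<^sub>0) within {z. cos (\<theta> / 2) * norm (z - h s\<^sub>0) \<le> (z - h s\<^sub>0) \<bullet> (of_real n * \<i> * v)})"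
    by (intro cauchy_integral_cone_limit[OF s0 der v n _ _ F outer]) auto
  show "((\<lambda>z. of_real n / (2 * of_real pi * \<i>) * cauchy_integral F z) \<longlongrightarrow> F s\<^sub>0)
     (at (h s\<^sub>0) within inside (path_image g) \<inter> symmetric_angle (h s\<^sub>0) (of_real n * \<i> * v) \<theta>)"
    by (rule tendsto_within_subset[OF lim]) (use symmetric_angle_inner[OF _ \<nu>] \<theta> in auto)
qed

end

theorem proposition6:
  fixes \<delta> :: "real \<Rightarrow> complex" and U :: "complex set" and f :: "complex \<Rightarrow> complex"
  assumes "rectifiable_Jordan_curve \<delta>"
    and "U = inside (path_image \<delta>)"
    and "continuous_on (path_image \<delta>) f"
    and "\<And>P :: complex poly. has_line_integral (\<lambda>z. poly P z * f z) 0 \<delta>"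
  shows "\<exists>\<phi>. \<phi> holomorphic_on U \<and>
           (AE \<zeta> in arc_length_measure \<delta>. has_nontangential_limit \<delta> \<phi> \<zeta> (f \<zeta>))"
proof -
  interpret rectifiable_Jordan \<delta> by unfold_locales (rule assms(1))
  obtain n :: real where n: "n = 1 \<or> n = -1"
    "\<And>z. z \<in> inside (path_image \<delta>) \<Longrightarrow> winding_number \<delta> z = of_real n"
    using orientation by blast
  define F where "F s = f (h s)" for s
  have F: "continuous_on {0..L} F"
    unfolding F_def by (rule continuous_on_compose2[OF assms(3) continuous_h]) (simp add: path_image_h)
  have moments: "integral {0..L} (\<lambda>s. poly P (h s) * F s * u s) = 0" for P :: "complex poly"
    unfolding F_def
    by (rule line_integral_eq[symmetric]) (intro continuous_intros assms(3,4))+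
  have outer: "cauchy_integral F z = 0" if "z \<in> outside (path_image \<delta>)" for z
    using cauchy_integral_zero_outside[OF F moments] that by (simp add: path_image_h)
  define \<phi> where "\<phi> z = of_real n / (2 * of_real pi * \<i>) * cauchy_integral F z" for z
  have "U \<subseteq> - h ` {0..L}"
    using inside_no_overlap[of "path_image \<delta>"] unfolding assms(2) path_image_h by blast
  then have "\<phi> holomorphic_on U"
    unfolding \<phi>_def by (intro holomorphic_intros holomorphic_on_subset[OF cauchy_integral_holomorphic[OF F]])
  moreover have "AE \<zeta> in arc_length_measure \<delta>. has_nontangential_limit \<delta> \<phi> \<zeta> (f \<zeta>)"
  proof (rule AE_arc_length_measure)
    show "negligible ({s \<in> {0..L}. \<not> (\<exists>v. norm v = 1 \<and> (h has_vector_derivative v) (at s))} \<union> {0, L})"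
      by (intro negligible_Un unit_derivative_ae negligible_finite) auto
    fix s assume s: "s \<in> {0..L} - ({s \<in> {0..L}. \<not> (\<exists>v. norm v = 1 \<and> (h has_vector_derivative v) (at s))} \<union> {0, L})"
    then obtain v where v: "norm v = 1" "(h has_vector_derivative v) (at s)" by blast
    have "s \<in> {0<..<L}" using s by auto
    from nontangential_limit[OF this v(2,1) n F outer]
    show "has_nontangential_limit \<delta> \<phi> (h s) (f (h s))" by (simp add: \<phi>_def[abs_def] F_def)
  qed
  ultimately show ?thesis by blast
qed

end
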